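(* Let $G\subset X$ be a $p$-path almost open measurable set and let $u\in D^p_{\rm loc}(X)$. Then $g_{u,G}=g_u$ a.e. in $G$, i.e. $g_u|_G$ is a minimal $p$-weak upper gradient of $u$ with respect to $G$.
   Context: $1\le p<\infty$ and $X=(X,d,\mu)$ is a metric space with a Borel regular measure $\mu$ (defined on the completion of the Borel $\sigma$-algebra) such that $0<\mu(B)<\infty$ for all balls $B$ (balls are nonempty and open). Curves are nonconstant, compact and rectifiable, parameterized by arc length as $\gamma:[0,l_\gamma]\to X$. A property holds for $p$-almost every curve if the family $\Gamma$ of curves for which it fails has zero $p$-modulus, i.e. there is a nonnegative Borel $\rho\in L^p(X)$ with $\int_\gamma\rho\,ds=\infty$ for every $\gamma\in\Gamma$. A nonnegative Borel function $g$ is an upper gradient of $u:X\to[-\infty,\infty]$ if $|u(\gamma(0))-u(\gamma(l_\gamma))|\le\int_\gamma g\,ds$ for all curves $\gamma$ (the left-hand side is $\infty$ whenever both terms are infinite); a nonnegative measurable $g$ is a $p$-weak upper gradient if this holds for $p$-almost every curve. If $u$ has an upper gradient in $L^p_{\rm loc}(X)$ (local: each point has a ball on which the property holds), its minimal $p$-weak upper gradient $g_u\in L^p_{\rm loc}(X)$ is the (a.e. unique) $p$-weak upper gradient satisfying $g_u\le g$ a.e. for every $p$-weak upper gradient $g\in L^p_{\rm loc}(X)$ of $u$. $D^p(X)$ is the set of everywhere defined measurable functions $u:X\to[-\infty,\infty]$ having an upper gradient in $L^p(X)$; $u\in D^p_{\rm loc}(X)$ if for every $x\in X$ there is a ball $B_x\ni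 x$ such that $u\in D^p(B_x)$. For measurable $G\subset X$, function spaces on $G$ and the minimal $p$-weak upper gradient $g_{u,G}$ are defined by regarding $G$ as a metric space on its own (with $d$, $\mu$ restricted to $G$, and only curves in $G$); $g_u:=g_{u,X}$. A set $G\subset X$ is $p$-path almost open (in $X$) if for $p$-almost every curve $\gamma:[0,l_\gamma]\to X$, the set $\gamma^{-1}(G)$ is the union of a (relatively) open subset of $[0,l_\gamma]$ and a set with zero one-dimensional Lebesgue measure. *)

theory Defs
  imports "HOL-Analysis.Analysis"
begin

text \<open>The ambient space \<open>X\<close> is the whole type. Every notion below takes a subset \<open>S\<close>
  that is regarded as a metric space on its own: its balls are \<open>ball c r \<inter> S\<close> with
  \<open>c \<in> S\<close>, its measure is \<open>restrict_space \<mu> S\<close>, its Borel sets are those of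
  \<open>restrict_space borel S\<close>, and its curves are the curves with image in \<open>S\<close>.
  Functions on \<open>S\<close> are total functions of which only the values on \<open>S\<close> matter.\<close>

text \<open>Borel regularity is automatic for the completion of a Borel measure: each set of the
  completed sigma-algebra lies in a Borel set of the same measure.\<close>

definition metric_measure :: "'a::metric_space measure \<Rightarrow> bool" where
  "metric_measure \<mu> \<longleftrightarrow>
     (\<exists>\<nu>. sets \<nu> = sets borel \<and> \<mu> = completion \<nu>) \<and>
     (\<forall>x r. 0 < r \<longrightarrow> 0 < emeasure \<mu> (ball x r) \<and> emeasure \<mu> (ball x r) < \<infinity>)"

definition ennreal_powr :: "ennreal \<Rightarrow> real \<Rightarrow> ennreal" where
  "ennreal_powr a p = (if a = \<infinity> then \<infinity> else ennreal (enn2real a powr p))"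

definition in_Lp :: "real \<Rightarrow> 'a measure \<Rightarrow> ('a \<Rightarrow> ennreal) \<Rightarrow> bool" where
  "in_Lp p M f \<longleftrightarrow> f \<in> borel_measurable M \<and> (\<integral>\<^sup>+x. ennreal_powr (f x) p \<partial>M) < \<infinity>"

definition locally_on_balls :: "'a::metric_space set \<Rightarrow> ('a set \<Rightarrow> bool) \<Rightarrow> bool" where
  "locally_on_balls S P \<longleftrightarrow>
     (\<forall>x\<in>S. \<exists>c\<in>S. \<exists>r>0. x \<in> ball c r \<and> P (ball c r \<inter> S))"

definition in_Lp_loc :: "real \<Rightarrow> 'a::metric_space measure \<Rightarrow> 'a set \<Rightarrow> ('a \<Rightarrow> ennreal) \<Rightarrow> bool" where
  "in_Lp_loc p \<mu> S f \<longleftrightarrow> locally_on_balls S (\<lambda>B. in_Lp p (restrict_space \<mu> B) f)"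

definition curve_length :: "(real \<Rightarrow> 'a::metric_space) \<Rightarrow> real \<Rightarrow> real \<Rightarrow> ennreal" where
  "curve_length \<gamma> a b =
     (SUP (n, t) \<in> UNIV \<times> {t :: nat \<Rightarrow> real. mono t \<and> range t \<subseteq> {a..b}}.
        \<Sum>i<n. ennreal (dist (\<gamma> (t i)) (\<gamma> (t (Suc i)))))"

text \<open>A curve is a pair of its length \<open>l\<close> and its arc length parameterization, whose values
  outside \<open>{0..l}\<close> are irrelevant. It is rectifiable, and nonconstant because \<open>l > 0\<close>.\<close>

definition curves :: "'a::metric_space set \<Rightarrow> (real \<times> (real \<Rightarrow> 'a)) set" where
  "curves S = {(l, \<gamma>). 0 < l \<and> \<gamma> ` {0..l} \<subseteq> S \<and> continuous_on {0..l} \<gamma> \<and>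
     (\<forall>s t. 0 \<le> s \<longrightarrow> s \<le> t \<longrightarrow> t \<le> l \<longrightarrow> curve_length \<gamma> s t = ennreal (t - s))}"

definition line_integral :: "real \<times> (real \<Rightarrow> 'a) \<Rightarrow> ('a \<Rightarrow> ennreal) \<Rightarrow> ennreal" where
  "line_integral = (\<lambda>(l, \<gamma>) \<rho>. \<integral>\<^sup>+t. \<rho> (\<gamma> t) \<partial>lebesgue_on {0..l})"

definition zero_modulus ::
    "real \<Rightarrow> 'a::metric_space measure \<Rightarrow> 'a set \<Rightarrow> (real \<times> (real \<Rightarrow> 'a)) set \<Rightarrow> bool" where
  "zero_modulus p \<mu> S \<Gamma> \<longleftrightarrow>
     (\<exists>\<rho>. \<rho> \<in> borel_measurable (restrict_space borel S) \<and> in_Lp p (restrict_space \<mu> S) \<rho> \<and>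
          (\<forall>c\<in>\<Gamma>. line_integral c \<rho> = \<infinity>))"

definition almost_every_curve ::
    "real \<Rightarrow> 'a::metric_space measure \<Rightarrow> 'a set \<Rightarrow> (real \<times> (real \<Rightarrow> 'a) \<Rightarrow> bool) \<Rightarrow> bool" where
  "almost_every_curve p \<mu> S P \<longleftrightarrow> zero_modulus p \<mu> S {c \<in> curves S. \<not> P c}"

definition abs_diff :: "ereal \<Rightarrow> ereal \<Rightarrow> ennreal" where
  "abs_diff a b = (if \<bar>a\<bar> = \<infinity> \<and> \<bar>b\<bar> = \<infinity> then \<infinity> else e2ennreal \<bar>a - b\<bar>)"

text \<open>The measurability clause says that the line integral of \<open>g\<close> is defined. It holds on every
  curve for Borel \<open>g\<close>, and on almost every curve for measurable \<open>g\<close>.\<close>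

definition ug_inequality ::
    "('a \<Rightarrow> ereal) \<Rightarrow> ('a \<Rightarrow> ennreal) \<Rightarrow> real \<times> (real \<Rightarrow> 'a) \<Rightarrow> bool" where
  "ug_inequality u g = (\<lambda>(l, \<gamma>). (\<lambda>t. g (\<gamma> t)) \<in> borel_measurable (lebesgue_on {0..l}) \<and>
     abs_diff (u (\<gamma> 0)) (u (\<gamma> l)) \<le> line_integral (l, \<gamma>) g)"

definition upper_gradient ::
    "'a::metric_space set \<Rightarrow> ('a \<Rightarrow> ereal) \<Rightarrow> ('a \<Rightarrow> ennreal) \<Rightarrow> bool" where
  "upper_gradient S u g \<longleftrightarrow>
     g \<in> borel_measurable (restrict_space borel S) \<and> (\<forall>c\<in>curves S. ug_inequality u g c)"

definition weak_upper_gradient ::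
    "real \<Rightarrow> 'a::metric_space measure \<Rightarrow> 'a set \<Rightarrow> ('a \<Rightarrow> ereal) \<Rightarrow> ('a \<Rightarrow> ennreal) \<Rightarrow> bool" where
  "weak_upper_gradient p \<mu> S u g \<longleftrightarrow>
     g \<in> borel_measurable (restrict_space \<mu> S) \<and> almost_every_curve p \<mu> S (ug_inequality u g)"

text \<open>A minimal weak upper gradient is only unique a.e., so it is rendered as a predicate
  satisfied by each of its representatives.\<close>

definition minimal_weak_upper_gradient ::
    "real \<Rightarrow> 'a::metric_space measure \<Rightarrow> 'a set \<Rightarrow> ('a \<Rightarrow> ereal) \<Rightarrow> ('a \<Rightarrow> ennreal) \<Rightarrow> bool" where
  "minimal_weak_upper_gradient p \<mu> S u g \<longleftrightarrow>
     weak_upper_gradient p \<mu> S u g \<and> in_Lp_loc p \<mu> S g \<and>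
     (\<forall>h. weak_upper_gradient p \<mu> S u h \<and> in_Lp_loc p \<mu> S h \<longrightarrow>
          (AE x in restrict_space \<mu> S. g x \<le> h x))"

definition Dp :: "real \<Rightarrow> 'a::metric_space measure \<Rightarrow> 'a set \<Rightarrow> ('a \<Rightarrow> ereal) set" where
  "Dp p \<mu> S = {u. u \<in> borel_measurable (restrict_space \<mu> S) \<and>
     (\<exists>g. upper_gradient S u g \<and> in_Lp p (restrict_space \<mu> S) g)}"

definition Dp_loc :: "real \<Rightarrow> 'a::metric_space measure \<Rightarrow> 'a set \<Rightarrow> ('a \<Rightarrow> ereal) set" where
  "Dp_loc p \<mu> S = {u. locally_on_balls S (\<lambda>B. u \<in> Dp p \<mu> B)}"

definition path_almost_open :: "real \<Rightarrow> 'a::metric_space measure \<Rightarrow> 'a set \<Rightarrow> bool" where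
  "path_almost_open p \<mu> G \<longleftrightarrow> almost_every_curve p \<mu> UNIV
     (\<lambda>(l, \<gamma>). \<exists>U N. openin (top_of_set {0..l}) U \<and> N \<in> null_sets lebesgue \<and>
                      {t \<in> {0..l}. \<gamma> t \<in> G} = U \<union> N)"

end

theory Submission
  imports Defs
begin

text \<open>Restricting to fewer curves shows that \<open>g\<^sub>u\<close> is a weak upper gradient on \<open>G\<close>. For minimality,
  let \<open>h\<close> be a locally \<open>p\<close>-integrable weak upper gradient of \<open>u\<close> with respect to \<open>G\<close>, and put
  \<open>k = min g\<^sub>u h\<close> in \<open>G\<close> and \<open>k = g\<^sub>u\<close> elsewhere. On almost every curve \<open>\<gamma>\<close>, the increments of
  \<open>u \<circ> \<gamma>\<close> are bounded by the integrals of \<open>g\<^sub>u \<circ> \<gamma>\<close>, and on the intervals inside the open part of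
  the preimage of \<open>G\<close> under \<open>\<gamma>\<close> also by those of \<open>h \<circ> \<gamma>\<close>; hence they are bounded by the integrals of
  \<open>k \<circ> \<gamma>\<close>. So \<open>k\<close> is a weak upper gradient on the whole space, and the minimality of \<open>g\<^sub>u\<close> there
  gives \<open>g\<^sub>u \<le> k \<le> h\<close> almost everywhere in \<open>G\<close>.\<close>

subsection \<open>Increments bounded by two integrals\<close>

text \<open>The combination of \<open>A\<close> and \<open>B\<close> is tested tag by tag, which avoids differentiating \<open>f\<close>:
  on an interval of a fine division the Henstock lemma replaces \<open>integral K A\<close> by
  \<open>\<bar>K\<bar> * A x\<close> up to a summable error, and likewise for \<open>B\<close> and \<open>W\<close>; tags in \<open>T\<close> have intervals
  inside \<open>T\<close>.\<close>

lemma abs_increment_le_integral: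
  fixes f A B W :: "real \<Rightarrow> real"
  assumes ab: "a \<le> b" and T: "open T"
    and A: "A integrable_on {a..b}" and B: "B integrable_on {a..b}" and W: "W integrable_on {a..b}"
    and fA: "\<And>c d. a \<le> c \<Longrightarrow> c \<le> d \<Longrightarrow> d \<le> b \<Longrightarrow> \<bar>f d - f c\<bar> \<le> integral {c..d} A"
    and fB: "\<And>c d. a \<le> c \<Longrightarrow> c \<le> d \<Longrightarrow> d \<le> b \<Longrightarrow> {c..d} \<subseteq> T \<Longrightarrow>
               \<bar>f d - f c\<bar> \<le> integral {c..d} B"
    and cases: "\<And>x. x \<in> {a..b} \<Longrightarrow> W x = A x \<or> x \<in> T \<and> W x = B x"
  shows "\<bar>f b - f a\<bar> \<le> integral {a..b} W"
proof (rule field_le_epsilon)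
  fix e :: real assume "0 < e"
  then have e3: "0 < e / 3" by simp
  let ?err = "\<lambda>F (x::real, K). norm (measure lborel K *\<^sub>R F x - integral K F)"
  obtain \<gamma>A where \<gamma>A: "gauge \<gamma>A"
    "\<And>p. p tagged_partial_division_of cbox a b \<Longrightarrow> \<gamma>A fine p \<Longrightarrow> sum (?err A) p < e / 3"
    using Henstock_lemma[of A a b "e / 3"] A e3 by auto
  obtain \<gamma>B where \<gamma>B: "gauge \<gamma>B"
    "\<And>p. p tagged_partial_division_of cbox a b \<Longrightarrow> \<gamma>B fine p \<Longrightarrow> sum (?err B) p < e / 3"
    using Henstock_lemma[of B a b "e / 3"] B e3 by auto
  obtain \<gamma>W where \<gamma>W: "gauge \<gamma>W"
    "\<And>p. p tagged_partial_division_of cbox a b \<Longrightarrow> \<gamma>W fine p \<Longrightarrow> sum (?err W) p < e / 3"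
    using Henstock_lemma[of W a b "e / 3"] W e3 by auto
  have "gauge (\<lambda>x. if x \<in> T then T else UNIV)"
    using T by (auto simp: gauge_def)
  then have "gauge (\<lambda>x. (\<gamma>A x \<inter> \<gamma>B x) \<inter> (\<gamma>W x \<inter> (if x \<in> T then T else UNIV)))"
    using \<gamma>A(1) \<gamma>B(1) \<gamma>W(1) by (intro gauge_Int)
  then obtain p where p: "p tagged_division_of {a..b}"
    and "(\<lambda>x. (\<gamma>A x \<inter> \<gamma>B x) \<inter> (\<gamma>W x \<inter> (if x \<in> T then T else UNIV))) fine p"
    by (rule fine_division_exists_real)
  then have fine: "\<gamma>A fine p" "\<gamma>B fine p" "\<gamma>W fine p" "(\<lambda>x. if x \<in> T then T else UNIV) fine p"
    unfolding fine_Int by auto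
  have pp: "p tagged_partial_division_of cbox a b"
    using p by (simp add: tagged_division_of_def)
  note pD = tagged_division_ofD[OF p]
  \<comment> \<open>A tag with \<open>W x = A x\<close> costs the errors of \<open>A\<close> and
    \<open>W\<close>, any other tag those of \<open>B\<close> and \<open>W\<close>. All three stand
    in the bound so that one estimate serves every tag; the extra error is nonnegative.\<close>
  have point: "\<bar>f (Sup K) - f (Inf K)\<bar> \<le> integral K W + ?err A (x, K) + ?err B (x, K) + ?err W (x, K)"
    if xK: "(x, K) \<in> p" for x K
  proof -
    obtain c d where K: "K = {c..d}" using pD(4)[OF xK] by auto
    have x: "x \<in> K" and sub: "K \<subseteq> {a..b}" using pD(2,3)[OF xK] by auto
    then have cd: "a \<le> c" "c \<le> d" "d \<le> b" using K by auto
    have SI: "Sup K = d" "Inf K = c" using cd K by auto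
    have "W x = A x \<or> x \<in> T \<and> W x = B x" using cases x sub by blast
    then show ?thesis
    proof
      assume "W x = A x"
      then have "measure lborel K * W x = measure lborel K * A x" by simp
      then show ?thesis
        using fA[OF cd, folded K] unfolding SI prod.case real_norm_def real_scaleR_def by linarith
    next
      assume *: "x \<in> T \<and> W x = B x"
      then have "K \<subseteq> T" using fine(4) xK unfolding fine_def by fastforce
      then have "\<bar>f d - f c\<bar> \<le> integral K B" using fB[OF cd] K by simp
      moreover have "measure lborel K * W x = measure lborel K * B x" using * by simp
      ultimately show ?thesis
        unfolding SI prod.case real_norm_def real_scaleR_def by linarith
    qed
  qed
  have "f b - f a = (\<Sum>(x, K)\<in>p. f (Sup K) - f (Inf K))"
    using additive_tagged_division_1[OF ab p, of f] by simp
  then have "\<bar>f b - f a\<bar> \<le> (\<Sum>(x, K)\<in>p. \<bar>f (Sup K) - f (Inf K)\<bar>)"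
    by (metis (mono_tags, lifting) sum_abs sum.cong case_prod_beta)
  also have "\<dots> \<le> (\<Sum>(x, K)\<in>p. integral K W + ?err A (x, K) + ?err B (x, K) + ?err W (x, K))"
    using point by (intro sum_mono) auto
  also have "\<dots> = (\<Sum>(x, K)\<in>p. integral K W) + sum (?err A) p + sum (?err B) p + sum (?err W) p"
    by (simp add: sum.distrib case_prod_beta)
  also have "(\<Sum>(x, K)\<in>p. integral K W) = integral {a..b} W"
    using integral_combine_tagged_division_topdown[of W a b p] W p by simp
  finally show "\<bar>f b - f a\<bar> \<le> integral {a..b} W + e"
    using \<gamma>A(2)[OF pp fine(1)] \<gamma>B(2)[OF pp fine(2)] \<gamma>W(2)[OF pp fine(3)] by linarith
qed

text \<open>A finite integral forces \<open>A\<close> to be finite a.e., so the value 0 that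
  \<open>enn2real\<close> gives to infinity matters only on a null set.\<close>

lemma integral_enn2real:
  assumes A: "A \<in> borel_measurable (lebesgue_on {c..d::real})"
    and fin: "(\<integral>\<^sup>+t. A t \<partial>lebesgue_on {c..d}) < \<infinity>"
  shows "(\<lambda>t. enn2real (A t)) integrable_on {c..d}"
    and "ennreal (integral {c..d} (\<lambda>t. enn2real (A t))) = (\<integral>\<^sup>+t. A t \<partial>lebesgue_on {c..d})"
proof -
  let ?M = "lebesgue_on {c..d}"
  have "AE t in ?M. A t \<noteq> \<infinity>"
    using nn_integral_noteq_infinite[OF A] fin by auto
  then have eq: "(\<integral>\<^sup>+t. ennreal (enn2real (A t)) \<partial>?M) = (\<integral>\<^sup>+t. A t \<partial>?M)"
    by (intro nn_integral_cong_AE) (auto simp: less_top)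
  have int: "integrable ?M (\<lambda>t. enn2real (A t))"
    using A fin eq by (intro integrableI_nonneg) auto
  then show "(\<lambda>t. enn2real (A t)) integrable_on {c..d}"
    by (rule integrable_on_lebesgue_on) simp
  have "integral {c..d} (\<lambda>t. enn2real (A t)) = integral\<^sup>L ?M (\<lambda>t. enn2real (A t))"
    using lebesgue_integral_eq_integral[OF int] by simp
  then show "ennreal (integral {c..d} (\<lambda>t. enn2real (A t))) = (\<integral>\<^sup>+t. A t \<partial>?M)"
    using nn_integral_eq_integral[OF int] eq by simp
qed

lemma nn_integral_lebesgue_on_mono:
  assumes "S \<subseteq> T" "S \<in> sets lebesgue" "T \<in> sets lebesgue"
  shows "(\<integral>\<^sup>+t. f t \<partial>lebesgue_on S) \<le> (\<integral>\<^sup>+t. f t \<partial>lebesgue_on T)"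
proof -
  have "(\<integral>\<^sup>+t. f t * indicator S t \<partial>lebesgue) \<le> (\<integral>\<^sup>+t. f t * indicator T t \<partial>lebesgue)"
    using assms(1) by (intro nn_integral_mono) (auto split: split_indicator)
  then show ?thesis using assms by (simp add: nn_integral_restrict_space)
qed

lemma measurable_lebesgue_on_subset:
  assumes "f \<in> borel_measurable (lebesgue_on T)" "S \<subseteq> T"
  shows "f \<in> borel_measurable (lebesgue_on S)"
  using assms by (rule measurable_restrict_mono)

text \<open>Fits \<open>abs_increment_le_integral\<close> to line integrals: the integrands may be
  infinite on null sets, the alternative may fail on a null set, and \<open>c < d\<close> reflects
  that curves have positive length.\<close>

lemma ennreal_abs_increment_le_nn_integral:
  fixes f :: "real \<Rightarrow> real" and A B W :: "real \<Rightarrow> ennreal"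
  assumes ab: "a \<le> b" and T: "open T"
    and A: "A \<in> borel_measurable (lebesgue_on {a..b})" "(\<integral>\<^sup>+t. A t \<partial>lebesgue_on {a..b}) < \<infinity>"
    and B: "B \<in> borel_measurable (lebesgue_on {a..b})" "(\<integral>\<^sup>+t. B t \<partial>lebesgue_on {a..b}) < \<infinity>"
    and W: "W \<in> borel_measurable (lebesgue_on {a..b})" "(\<integral>\<^sup>+t. W t \<partial>lebesgue_on {a..b}) < \<infinity>"
    and fA: "\<And>c d. a \<le> c \<Longrightarrow> c < d \<Longrightarrow> d \<le> b \<Longrightarrow>
               ennreal \<bar>f d - f c\<bar> \<le> (\<integral>\<^sup>+t. A t \<partial>lebesgue_on {c..d})"
    and fB: "\<And>c d. a \<le> c \<Longrightarrow> c < d \<Longrightarrow> d \<le> b \<Longrightarrow> {c..d} \<subseteq> T \<Longrightarrow>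
               ennreal \<bar>f d - f c\<bar> \<le> (\<integral>\<^sup>+t. B t \<partial>lebesgue_on {c..d})"
    and cases: "AE t in lebesgue_on {a..b}. W t = A t \<or> t \<in> T \<and> W t = B t"
  shows "ennreal \<bar>f b - f a\<bar> \<le> (\<integral>\<^sup>+t. W t \<partial>lebesgue_on {a..b})"
proof -
  let ?M = "lebesgue_on {a..b}"
  \<comment> \<open>The real-valued lemma wants the alternative at every point; \<open>V\<close>
    falls back to \<open>A\<close> where it fails, which changes \<open>W\<close> only on a null
    set.\<close>
  define V where "V t = (if W t = A t \<or> t \<in> T \<and> W t = B t then W t else A t)" for t
  have VW: "AE t in ?M. W t = V t" using cases by eventually_elim (auto simp: V_def)
  have "Measurable.pred lebesgue (\<lambda>t. t \<in> T)"
    using T by (simp add: pred_def borel_open)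
  then have [measurable]: "Measurable.pred ?M (\<lambda>t. t \<in> T)"
    by (rule measurable_restrict_space1)
  note [measurable] = A(1) B(1) W(1)
  have V: "V \<in> borel_measurable ?M" unfolding V_def by measurable
  have intV: "(\<integral>\<^sup>+t. V t \<partial>?M) = (\<integral>\<^sup>+t. W t \<partial>?M)"
    using VW by (intro nn_integral_cong_AE) auto
  have sub: "ennreal (integral {c..d} (\<lambda>t. enn2real (F t))) = (\<integral>\<^sup>+t. F t \<partial>lebesgue_on {c..d})"
    if "F \<in> borel_measurable ?M" "(\<integral>\<^sup>+t. F t \<partial>?M) < \<infinity>" "a \<le> c" "d \<le> b" for F c d
    using that nn_integral_lebesgue_on_mono[of "{c..d}" "{a..b}" F]
    by (intro integral_enn2real(2) measurable_lebesgue_on_subset[OF that(1)]) auto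
  have le: "\<bar>f d - f c\<bar> \<le> integral {c..d} (\<lambda>t. enn2real (F t))"
    if "ennreal \<bar>f d - f c\<bar> \<le> (\<integral>\<^sup>+t. F t \<partial>lebesgue_on {c..d})"
      "F \<in> borel_measurable ?M" "(\<integral>\<^sup>+t. F t \<partial>?M) < \<infinity>" "a \<le> c" "d \<le> b" for F c d
  proof -
    have "ennreal \<bar>f d - f c\<bar> \<le> ennreal (integral {c..d} (\<lambda>t. enn2real (F t)))"
      using that sub[of F c d] by simp
    \<comment> \<open>\<open>ennreal\<close> truncates negative reals to 0, so cancelling it needs a
      nonnegative right-hand side; a nonintegrable function has \<open>integral\<close> 0 by
      convention.\<close>
    moreover have "0 \<le> integral {c..d} (\<lambda>t. enn2real (F t))"
      by (cases "(\<lambda>t. enn2real (F t)) integrable_on {c..d}")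
        (auto intro: Henstock_Kurzweil_Integration.integral_nonneg simp: not_integrable_integral)
    ultimately show ?thesis by (simp add: ennreal_le_iff)
  qed
  have "\<bar>f b - f a\<bar> \<le> integral {a..b} (\<lambda>t. enn2real (V t))"
  proof (rule abs_increment_le_integral[OF ab T])
    show "(\<lambda>t. enn2real (A t)) integrable_on {a..b}" "(\<lambda>t. enn2real (B t)) integrable_on {a..b}"
      "(\<lambda>t. enn2real (V t)) integrable_on {a..b}"
      using A B V W(2) intV by (auto intro!: integral_enn2real(1))
    show "\<bar>f d - f c\<bar> \<le> integral {c..d} (\<lambda>t. enn2real (A t))" if "a \<le> c" "c \<le> d" "d \<le> b" for c d
      using le[OF fA A] that by (cases "c = d") auto
    show "\<bar>f d - f c\<bar> \<le> integral {c..d} (\<lambda>t. enn2real (B t))"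
      if "a \<le> c" "c \<le> d" "d \<le> b" "{c..d} \<subseteq> T" for c d
      using le[OF fB B] that by (cases "c = d") auto
  qed (auto simp: V_def)
  then have "ennreal \<bar>f b - f a\<bar> \<le> ennreal (integral {a..b} (\<lambda>t. enn2real (V t)))"
    by (rule ennreal_leI)
  also have "\<dots> = (\<integral>\<^sup>+t. W t \<partial>?M)"
    using sub[OF V] intV W(2) by simp
  finally show ?thesis .
qed

subsection \<open>Modulus and Lebesgue spaces\<close>

lemma ennreal_powr_mono: "a \<le> b \<Longrightarrow> 0 < p \<Longrightarrow> ennreal_powr a p \<le> ennreal_powr b p"
  by (auto simp: ennreal_powr_def top_unique less_top intro!: ennreal_leI powr_mono2 enn2real_mono)

lemma ennreal_powr_powr_inverse: "0 < p \<Longrightarrow> ennreal_powr (ennreal_powr a p) (1 / p) = a"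
  by (cases a) (auto simp: ennreal_powr_def powr_powr)

text \<open>The power \<open>1 / p\<close> inverts the power \<open>p\<close>, also at infinity, and
  both are monotone. So the bound on the powers is pulled back to the \<open>a i\<close>, passes to
  their supremum and is raised again.\<close>

lemma ennreal_powr_SUP_le:
  fixes a :: "'i \<Rightarrow> ennreal"
  assumes "0 < p" "\<And>i. i \<in> I \<Longrightarrow> ennreal_powr (a i) p \<le> s"
  shows "ennreal_powr (SUP i\<in>I. a i) p \<le> s"
proof -
  have "a i \<le> ennreal_powr s (1 / p)" if "i \<in> I" for i
    using ennreal_powr_mono[OF assms(2)[OF that], of "1 / p"] assms(1)
    by (simp add: ennreal_powr_powr_inverse)
  then have "(SUP i\<in>I. a i) \<le> ennreal_powr s (1 / p)" by (rule SUP_least)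
  then have "ennreal_powr (SUP i\<in>I. a i) p \<le> ennreal_powr (ennreal_powr s (1 / p)) p"
    using assms(1) by (rule ennreal_powr_mono)
  also have "\<dots> = s" using ennreal_powr_powr_inverse[of "1 / p" s] assms(1) by simp
  finally show ?thesis .
qed

lemma measurable_ennreal_powr [measurable (raw)]:
  assumes [measurable]: "f \<in> borel_measurable M"
  shows "(\<lambda>x. ennreal_powr (f x) p) \<in> borel_measurable M"
  unfolding ennreal_powr_def by measurable

text \<open>Homogeneity gives the factor \<open>c powr p\<close>, which is at most \<open>c\<close>
  since \<open>c <= 1 <= p\<close>. A weight linear in \<open>c\<close> is what the later sum of
  scaled test functions needs.\<close>

lemma ennreal_powr_cmult_le:
  assumes "0 \<le> c" "c \<le> 1" "1 \<le> p"
  shows "ennreal_powr (ennreal c * a) p \<le> ennreal c * ennreal_powr a p"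
proof (cases "c = 0 \<or> a = \<infinity>")
  case True
  then show ?thesis using assms
    by (cases "c = 0") (auto simp: ennreal_powr_def ennreal_mult_top)
next
  case False
  then obtain r where r: "a = ennreal r" "0 \<le> r" by (cases a) auto
  have "(c * r) powr p = c powr p * r powr p" using assms r by (simp add: powr_mult)
  also have "c powr p \<le> c" using powr_mono'[of 1 p c] assms False by simp
  finally have "(c * r) powr p \<le> c * r powr p" by (simp add: mult_right_mono)
  then show ?thesis using r assms
    by (simp add: ennreal_powr_def ennreal_mult[symmetric] ennreal_leI)
qed

lemma restrict_space_UNIV_eq [simp]: "restrict_space M UNIV = M"
  by (rule measure_eqI) (auto simp: sets_restrict_space emeasure_restrict_space)

lemma in_Lp_mono:
  assumes "in_Lp p M f" "g \<in> borel_measurable M" "\<And>x. x \<in> space M \<Longrightarrow> g x \<le> f x" "0 < p"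
  shows "in_Lp p M g"
proof -
  have "(\<integral>\<^sup>+x. ennreal_powr (g x) p \<partial>M) \<le> (\<integral>\<^sup>+x. ennreal_powr (f x) p \<partial>M)"
    using assms(3,4) by (intro nn_integral_mono ennreal_powr_mono) auto
  then show ?thesis using assms(1,2) unfolding in_Lp_def by (auto intro: le_less_trans)
qed

lemma in_Lp_restrict_space_iff:
  assumes "S \<in> sets M" "0 < p"
  shows "in_Lp p (restrict_space M S) f \<longleftrightarrow> in_Lp p M (\<lambda>x. f x * indicator S x)"
proof -
  have S: "S \<inter> space M \<in> sets M" using assms by auto
  have "ennreal_powr (f x * indicator S x) p = ennreal_powr (f x) p * indicator S x" for x
    using assms(2) by (auto simp: ennreal_powr_def split: split_indicator)
  then show ?thesis
    by (simp add: in_Lp_def borel_measurable_restrict_space_iff_ennreal[OF S]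
        nn_integral_restrict_space[OF S])
qed

lemma in_Lp_restrict_space_mono:
  assumes f: "in_Lp p (restrict_space M S) f" and ST: "T \<subseteq> S" "S \<in> sets M" "T \<in> sets M"
    and p: "0 < p" and g: "g \<in> borel_measurable (restrict_space M T)"
    and le: "\<And>x. x \<in> T \<Longrightarrow> g x \<le> f x"
  shows "in_Lp p (restrict_space M T) g"
proof -
  have "T \<inter> space M \<in> sets M" using ST by auto
  then have "(\<lambda>x. g x * indicator T x) \<in> borel_measurable M"
    using g by (simp add: borel_measurable_restrict_space_iff_ennreal)
  moreover have "g x * indicator T x \<le> f x * indicator S x" for x
    using le ST(1) by (auto split: split_indicator)
  ultimately show ?thesis
    using in_Lp_mono[of p M "\<lambda>x. f x * indicator S x" "\<lambda>x. g x * indicator T x"] f ST p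
    by (simp add: in_Lp_restrict_space_iff)
qed

section \<open>Borel representatives and majorants\<close>

lemma metric_measure_sets_borel:
  assumes "metric_measure \<mu>"
  shows "space \<mu> = UNIV" "sets borel \<subseteq> sets \<mu>"
proof -
  obtain \<nu> where \<nu>: "sets \<nu> = sets borel" "\<mu> = completion \<nu>"
    using assms by (auto simp: metric_measure_def)
  then show "space \<mu> = UNIV" using sets_eq_imp_space_eq[OF \<nu>(1)] by simp
  show "sets borel \<subseteq> sets \<mu>" using \<nu> by (metis subsetI sets_completionI_sets)
qed

lemma metric_measure_borel_measurable:
  assumes "metric_measure \<mu>" "f \<in> borel_measurable borel"
  shows "f \<in> borel_measurable \<mu>"
  using measurable_mono[of borel borel borel \<mu>] metric_measure_sets_borel[OF assms(1)] assms(2)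
  by auto

text \<open>Since \<mu> is the completion of a Borel measure \<nu>, the points where
  \<open>f\<close> and its Borel version differ lie in a \<nu>-null set, and that set is
  Borel.\<close>

lemma borel_version:
  fixes f :: "'a::metric_space \<Rightarrow> ennreal"
  assumes \<mu>: "metric_measure \<mu>" and f: "f \<in> borel_measurable \<mu>"
  obtains f' N where "f' \<in> borel_measurable borel" "N \<in> sets borel" "N \<in> null_sets \<mu>"
    "\<And>x. x \<notin> N \<Longrightarrow> f' x = f x"
proof -
  obtain \<nu> where \<nu>: "sets \<nu> = sets borel" "\<mu> = completion \<nu>"
    using \<mu> by (auto simp: metric_measure_def)
  then obtain f' where f': "f' \<in> borel_measurable \<nu>" "AE x in \<nu>. f x = f' x"
    using f completion_ex_borel_measurable by blast
  then obtain N where N: "{x\<in>space \<nu>. \<not> f x = f' x} \<subseteq> N" "N \<in> null_sets \<nu>"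
    by (metis AE_E null_setsI)
  have "space \<nu> = UNIV" using sets_eq_imp_space_eq[OF \<nu>(1)] by simp
  then have "f' x = f x" if "x \<notin> N" for x using N(1) that by force
  moreover have "f' \<in> borel_measurable borel"
    using f'(1) measurable_cong_sets[OF \<nu>(1) refl] by blast
  ultimately show ?thesis
    using N(2) \<nu> by (intro that[of f' N]) (auto intro: null_sets_completionI null_setsD2)
qed

text \<open>For Borel \<open>N\<close> this is a test function: a curve along which its line
  integral is finite spends zero length in \<open>N\<close>.\<close>

lemma in_Lp_infinity_null_set:
  assumes "N \<in> null_sets \<mu>" "0 < p"
  shows "in_Lp p \<mu> (\<lambda>x. \<infinity> * indicator N x)"
proof -
  have [measurable]: "N \<in> sets \<mu>" using assms by auto
  have "AE x in \<mu>. x \<notin> N" by (rule AE_not_in[OF assms(1)])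
  then have "AE x in \<mu>. ennreal_powr (\<infinity> * indicator N x) p = 0"
    by eventually_elim (use assms(2) in \<open>simp add: ennreal_powr_def\<close>)
  then have "(\<integral>\<^sup>+x. ennreal_powr (\<infinity> * indicator N x) p \<partial>\<mu>) = (\<integral>\<^sup>+x. 0 \<partial>\<mu>)"
    by (rule nn_integral_cong_AE)
  then show ?thesis by (simp add: in_Lp_def)
qed

text \<open>\<open>zero_modulus\<close> asks for a Borel function, but extending \<open>f\<close> by
  0 outside \<open>S\<close> gives one that is merely \<mu>-measurable. Its Borel version is raised
  to infinity on the exceptional null set, so that the bound holds at every point of
  \<open>S\<close>; curves may run inside null sets.\<close>

lemma borel_majorant:
  fixes f :: "'a::metric_space \<Rightarrow> ennreal"
  assumes \<mu>: "metric_measure \<mu>" and S: "S \<in> sets \<mu>" and p: "0 < p"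
    and f: "in_Lp p (restrict_space \<mu> S) f"
  obtains \<rho> where "\<rho> \<in> borel_measurable borel" "in_Lp p \<mu> \<rho>" "\<And>x. x \<in> S \<Longrightarrow> f x \<le> \<rho> x"
proof -
  define h where "h = (\<lambda>x. f x * indicator S x)"
  have f0: "in_Lp p \<mu> h"
    using f S p unfolding h_def by (simp add: in_Lp_restrict_space_iff)
  then have "h \<in> borel_measurable \<mu>" by (simp add: in_Lp_def)
  then obtain f' N where N: "f' \<in> borel_measurable borel" "N \<in> sets borel" "N \<in> null_sets \<mu>"
    "\<And>x. x \<notin> N \<Longrightarrow> f' x = h x"
    using borel_version[OF \<mu>, of h] by blast
  define \<rho> where "\<rho> x = (if x \<in> N then \<infinity> else f' x)" for x
  note [measurable] = N(1,2)
  have \<rho>: "\<rho> \<in> borel_measurable borel" unfolding \<rho>_def by measurable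
  have "AE x in \<mu>. x \<notin> N" by (rule AE_not_in[OF N(3)])
  then have "AE x in \<mu>. ennreal_powr (\<rho> x) p = ennreal_powr (h x) p"
    by eventually_elim (simp add: \<rho>_def N(4))
  then have "(\<integral>\<^sup>+x. ennreal_powr (\<rho> x) p \<partial>\<mu>) = (\<integral>\<^sup>+x. ennreal_powr (h x) p \<partial>\<mu>)"
    by (rule nn_integral_cong_AE)
  then have "in_Lp p \<mu> \<rho>"
    using f0 metric_measure_borel_measurable[OF \<mu> \<rho>] by (simp add: in_Lp_def)
  moreover have "f x \<le> \<rho> x" if "x \<in> S" for x using that N(4)[of x] by (simp add: \<rho>_def h_def)
  ultimately show ?thesis using that \<rho> by blast
qed

subsection \<open>Properties of almost every curve\<close>

lemma curves_UNIV: "c \<in> curves S \<Longrightarrow> c \<in> curves UNIV"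
  by (auto simp: curves_def)

lemma measurable_curve_comp:
  assumes "(l, \<gamma>) \<in> curves S" "\<rho> \<in> borel_measurable borel"
  shows "(\<lambda>t. \<rho> (\<gamma> t)) \<in> borel_measurable (lebesgue_on {0..l})"
proof -
  have "continuous_on {0..l} \<gamma>" using assms(1) by (simp add: curves_def)
  then have "\<gamma> \<in> borel_measurable (lebesgue_on {0..l})"
    by (rule continuous_imp_measurable_on_sets_lebesgue) simp
  then show ?thesis using assms(2) by (rule measurable_compose)
qed

section \<open>Translations and subcurves\<close>

lemma curve_length_shift_le:
  "curve_length (\<lambda>t. \<gamma> (a + t)) s t \<le> curve_length \<gamma> (a + s) (a + t)"
  unfolding curve_length_def
proof (rule SUP_mono)
  fix q :: "nat \<times> (nat \<Rightarrow> real)"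
  assume "q \<in> UNIV \<times> {t'. mono t' \<and> range t' \<subseteq> {s..t}}"
  then obtain n t' where q: "q = (n, t')" "mono t'" "range t' \<subseteq> {s..t}" by auto
  have "(n, \<lambda>i. a + t' i) \<in> UNIV \<times> {t'. mono t' \<and> range t' \<subseteq> {a + s..a + t}}"
    using q by (auto simp: mono_def)
  then show "\<exists>q'\<in>UNIV \<times> {t'. mono t' \<and> range t' \<subseteq> {a + s..a + t}}.
      (case q of (n, t') \<Rightarrow> \<Sum>i<n. ennreal (dist (\<gamma> (a + t' i)) (\<gamma> (a + t' (Suc i)))))
      \<le> (case q' of (n, t') \<Rightarrow> \<Sum>i<n. ennreal (dist (\<gamma> (t' i)) (\<gamma> (t' (Suc i)))))"
    by (rule bexI[rotated]) (simp add: q(1))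
qed

text \<open>The reverse inequality is \<open>curve_length_shift_le\<close> for the translate,
  shifted back by \<open>- a\<close>.\<close>

lemma curve_length_shift:
  "curve_length (\<lambda>t. \<gamma> (a + t)) s t = curve_length \<gamma> (a + s) (a + t)"
  using curve_length_shift_le[of \<gamma> a s t]
    curve_length_shift_le[of "\<lambda>t. \<gamma> (a + t)" "- a" "a + s" "a + t"] by simp

text \<open>The arc length condition speaks of all subintervals, so it passes to the piece between
  \<open>a\<close> and \<open>b\<close>; \<open>a < b\<close> keeps the length positive.\<close>

lemma subcurve_in_curves:
  assumes c: "(l, \<gamma>) \<in> curves T" and ab: "0 \<le> a" "a < b" "b \<le> l" and S: "\<gamma> ` {a..b} \<subseteq> S"
  shows "(b - a, \<lambda>t. \<gamma> (a + t)) \<in> curves S"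
proof -
  have "continuous_on {a..b} \<gamma>"
    using c ab by (auto simp: curves_def intro: continuous_on_subset)
  then have "continuous_on {0..b - a} (\<lambda>t. \<gamma> (a + t))"
    by (rule continuous_on_compose2) (auto intro!: continuous_intros)
  moreover have "(\<lambda>t. \<gamma> (a + t)) ` {0..b - a} \<subseteq> S"
    using S by (auto simp: image_subset_iff)
  ultimately show ?thesis
    using c ab by (auto simp: curves_def curve_length_shift)
qed

lemma measurable_lebesgue_on_shift:
  fixes F :: "real \<Rightarrow> ennreal"
  assumes "F \<in> borel_measurable (lebesgue_on {a + c..a + d})"
  shows "(\<lambda>t. F (a + t)) \<in> borel_measurable (lebesgue_on {c..d})"
proof -
  have "(\<lambda>t. a + t) \<in> lebesgue \<rightarrow>\<^sub>M lebesgue"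
    using lebesgue_affine_measurable[of "\<lambda>_. 1::real" a] by simp
  then have "(\<lambda>t. a + t) \<in> lebesgue_on {c..d} \<rightarrow>\<^sub>M lebesgue_on {a + c..a + d}"
    by (rule measurable_restrict_space3) auto
  then show ?thesis using assms by (rule measurable_compose)
qed

text \<open>Translation invariance of Lebesgue measure, applied to \<open>F\<close> cut off outside
  \<open>{a..b}\<close>.\<close>

lemma nn_integral_lebesgue_on_shift:
  fixes F :: "real \<Rightarrow> ennreal"
  assumes F: "F \<in> borel_measurable (lebesgue_on {a..b})"
  shows "(\<integral>\<^sup>+t. F (a + t) \<partial>lebesgue_on {0..b - a}) = (\<integral>\<^sup>+t. F t \<partial>lebesgue_on {a..b})"
proof -
  let ?F = "\<lambda>t. F t * indicator {a..b} t"
  have F': "?F \<in> borel_measurable lebesgue"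
    using F by (subst (asm) borel_measurable_restrict_space_iff_ennreal) auto
  have shift: "(\<lambda>t. a + t) \<in> lebesgue \<rightarrow>\<^sub>M lebesgue"
    using lebesgue_affine_measurable[of "\<lambda>_. 1::real" a] by simp
  have "lebesgue = distr lebesgue lebesgue (\<lambda>t. a + t)"
    using lebesgue_real_affine[of 1 a] by (simp add: density_1)
  then have "(\<integral>\<^sup>+t. ?F t \<partial>lebesgue) = (\<integral>\<^sup>+t. ?F t \<partial>distr lebesgue lebesgue (\<lambda>t. a + t))"
    by simp
  also have "\<dots> = (\<integral>\<^sup>+t. ?F (a + t) \<partial>lebesgue)"
    using shift F' by (simp add: nn_integral_distr)
  also have "\<dots> = (\<integral>\<^sup>+t. F (a + t) * indicator {0..b - a} t \<partial>lebesgue)"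
    by (intro nn_integral_cong) (auto split: split_indicator)
  finally show ?thesis by (simp add: nn_integral_restrict_space)
qed

section \<open>Exceptional families of curves\<close>

lemma almost_every_curve_mono:
  assumes "almost_every_curve p \<mu> S P" "\<And>c. c \<in> curves S \<Longrightarrow> P c \<Longrightarrow> Q c"
  shows "almost_every_curve p \<mu> S Q"
  using assms unfolding almost_every_curve_def zero_modulus_def by blast

lemma almost_every_curve_finite_line_integral:
  assumes "\<rho> \<in> borel_measurable borel" "in_Lp p \<mu> \<rho>"
  shows "almost_every_curve p \<mu> UNIV (\<lambda>c. line_integral c \<rho> < \<infinity>)"
  unfolding almost_every_curve_def zero_modulus_def
  using assms by (intro exI[of _ \<rho>]) (auto simp: less_top[symmetric])

text \<open>A countable supremum of suitably scaled functions stays in \<open>L\<^sup>p\<close> and inherits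
  the infinite line integrals of each of them.\<close>

lemma almost_every_curve_all_nat:
  fixes \<mu> :: "'a::metric_space measure"
  assumes \<mu>: "metric_measure \<mu>" and p: "1 \<le> p"
    and P: "\<And>i::nat. almost_every_curve p \<mu> UNIV (P i)"
  shows "almost_every_curve p \<mu> UNIV (\<lambda>c. \<forall>i. P i c)"
proof -
  have "\<forall>i. \<exists>\<rho>. \<rho> \<in> borel_measurable borel \<and> in_Lp p \<mu> \<rho> \<and>
      (\<forall>c\<in>{c \<in> curves UNIV. \<not> P i c}. line_integral c \<rho> = \<infinity>)"
    using P unfolding almost_every_curve_def zero_modulus_def by simp
  then obtain \<rho> where \<rho>: "\<And>i. \<rho> i \<in> borel_measurable borel" "\<And>i. in_Lp p \<mu> (\<rho> i)"
    "\<And>i c. c \<in> curves UNIV \<Longrightarrow> \<not> P i c \<Longrightarrow> line_integral c (\<rho> i) = \<infinity>"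
    by (metis (mono_tags, lifting) mem_Collect_eq)
  define m where "m i = enn2real (\<integral>\<^sup>+x. ennreal_powr (\<rho> i x) p \<partial>\<mu>)" for i
  have m: "(\<integral>\<^sup>+x. ennreal_powr (\<rho> i x) p \<partial>\<mu>) = ennreal (m i)" "0 \<le> m i" for i
    using \<rho>(2)[of i] by (auto simp: m_def in_Lp_def less_top)
  \<comment> \<open>The weights satisfy both \<open>s i <= 1\<close>, needed for
    \<open>ennreal_powr_cmult_le\<close>, and \<open>s i * m i <= (1/2)^Suc i\<close>, where the
    right-hand sides sum to 1; the \<open>1 +\<close> excludes division by 0.\<close>
  define s where "s i = (1/2)^Suc i / (1 + m i)" for i
  have s: "0 < s i" "s i \<le> 1" "s i * m i \<le> (1/2)^Suc i" for i
  proof -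
    show "0 < s i" using m(2)[of i] by (simp add: s_def)
    have "(1/2::real)^Suc i \<le> 1" by (rule power_le_one) auto
    then show "s i \<le> 1" using m(2)[of i] by (simp add: s_def divide_le_eq)
    show "s i * m i \<le> (1/2)^Suc i"
      using m(2)[of i] mult_left_le[of "m i / (1 + m i)" "(1/2)^Suc i"] by (simp add: s_def)
  qed
  define \<sigma> where "\<sigma> x = (SUP i. ennreal (s i) * \<rho> i x)" for x
  note [measurable] = \<rho>(1) metric_measure_borel_measurable[OF \<mu> \<rho>(1)]
  have \<sigma>_borel: "\<sigma> \<in> borel_measurable borel" unfolding \<sigma>_def by measurable
  have "ennreal_powr (\<sigma> x) p \<le> (\<Sum>i. ennreal (s i) * ennreal_powr (\<rho> i x) p)" for x
    unfolding \<sigma>_def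
  proof (rule ennreal_powr_SUP_le)
    fix i
    have "ennreal_powr (ennreal (s i) * \<rho> i x) p \<le> ennreal (s i) * ennreal_powr (\<rho> i x) p"
      using s[of i] p by (intro ennreal_powr_cmult_le) auto
    also have "\<dots> \<le> (\<Sum>i. ennreal (s i) * ennreal_powr (\<rho> i x) p)"
      using sum_le_suminf[of "\<lambda>i. ennreal (s i) * ennreal_powr (\<rho> i x) p" "{i}"] by simp
    finally show "ennreal_powr (ennreal (s i) * \<rho> i x) p
        \<le> (\<Sum>i. ennreal (s i) * ennreal_powr (\<rho> i x) p)" .
  qed (use p in simp)
  then have "(\<integral>\<^sup>+x. ennreal_powr (\<sigma> x) p \<partial>\<mu>)
      \<le> (\<integral>\<^sup>+x. (\<Sum>i. ennreal (s i) * ennreal_powr (\<rho> i x) p) \<partial>\<mu>)"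
    by (intro nn_integral_mono)
  also have "\<dots> = (\<Sum>i. ennreal (s i) * ennreal (m i))"
    by (simp add: nn_integral_suminf nn_integral_cmult m)
  also have "\<dots> \<le> (\<Sum>i. ennreal ((1/2)^Suc i))"
    using s m(2) by (intro suminf_le) (auto simp: ennreal_mult[symmetric] less_imp_le intro!: ennreal_leI)
  also have "\<dots> = ennreal 1"
    using power_half_series by (intro suminf_ennreal_eq) auto
  finally have "in_Lp p \<mu> \<sigma>"
    using metric_measure_borel_measurable[OF \<mu> \<sigma>_borel] by (auto simp: in_Lp_def intro: le_less_trans)
  moreover have "line_integral c \<sigma> = \<infinity>" if c: "c \<in> curves UNIV" "\<not> P i c" for c i
  proof -
    obtain l \<gamma> where c_eq: "c = (l, \<gamma>)" by (cases c)
    have [measurable]: "(\<lambda>t. \<rho> i (\<gamma> t)) \<in> borel_measurable (lebesgue_on {0..l})"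
      using c \<rho>(1) unfolding c_eq by (intro measurable_curve_comp)
    \<comment> \<open>Scaling by the positive \<open>s i\<close> keeps the integral infinite, and
      \<sigma> dominates each scaled \<open>\<rho> i\<close>.\<close>
    have "\<infinity> = ennreal (s i) * line_integral c (\<rho> i)"
      using \<rho>(3)[OF c] s(1)[of i] by (simp add: ennreal_mult_top)
    also have "\<dots> = (\<integral>\<^sup>+t. ennreal (s i) * \<rho> i (\<gamma> t) \<partial>lebesgue_on {0..l})"
      by (simp add: line_integral_def c_eq nn_integral_cmult)
    also have "\<dots> \<le> line_integral c \<sigma>"
      unfolding line_integral_def c_eq \<sigma>_def prod.case by (intro nn_integral_mono SUP_upper) auto
    finally show ?thesis by (simp add: top_unique)
  qed
  ultimately show ?thesis
    using \<sigma>_borel unfolding almost_every_curve_def zero_modulus_def by auto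
qed

lemma almost_every_curve_all_countable:
  assumes "metric_measure \<mu>" "1 \<le> p" "countable I"
    and "\<And>i. i \<in> I \<Longrightarrow> almost_every_curve p \<mu> UNIV (P i)"
  shows "almost_every_curve p \<mu> UNIV (\<lambda>c. \<forall>i\<in>I. P i c)"
\<comment> \<open>\<open>from_nat_into\<close> enumerates nonempty sets only; for empty
  \<open>I\<close> no curve is exceptional and the zero function is a witness.\<close>
proof (cases "I = {}")
  case True
  have "in_Lp p \<mu> (\<lambda>_. 0)" using assms(2) by (simp add: in_Lp_def ennreal_powr_def)
  then show ?thesis using True
    by (auto simp: almost_every_curve_def zero_modulus_def intro!: exI[of _ "\<lambda>_. 0"])
next
  case False
  then have "almost_every_curve p \<mu> UNIV (\<lambda>c. \<forall>n. P (from_nat_into I n) c)"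
    using assms by (intro almost_every_curve_all_nat) (auto intro: from_nat_into)
  then show ?thesis
    by (rule almost_every_curve_mono) (metis assms(3) from_nat_into_surj)
qed

lemma almost_every_curve_conj:
  assumes "metric_measure \<mu>" "1 \<le> p"
    and "almost_every_curve p \<mu> UNIV P" "almost_every_curve p \<mu> UNIV Q"
  shows "almost_every_curve p \<mu> UNIV (\<lambda>c. P c \<and> Q c)"
proof -
  have "almost_every_curve p \<mu> UNIV (\<lambda>c. \<forall>b\<in>UNIV. (if b then P else Q) c)"
    using assms by (intro almost_every_curve_all_countable) auto
  then show ?thesis by (rule almost_every_curve_mono) (metis UNIV_I)
qed

text \<open>\<open>f\<close> agrees with a Borel function outside a Borel null set \<open>N\<close>,
  and almost every curve meets \<open>N\<close> only for a null set of parameters; completeness of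
  Lebesgue measure does the rest.\<close>

lemma almost_every_curve_measurable:
  fixes f :: "'a::metric_space \<Rightarrow> ennreal"
  assumes \<mu>: "metric_measure \<mu>" and p: "1 \<le> p" and f: "f \<in> borel_measurable \<mu>"
  shows "almost_every_curve p \<mu> UNIV (\<lambda>(l, \<gamma>). (\<lambda>t. f (\<gamma> t)) \<in> borel_measurable (lebesgue_on {0..l}))"
proof -
  obtain f' N where f': "f' \<in> borel_measurable borel" and N: "N \<in> sets borel" "N \<in> null_sets \<mu>"
    and eq: "\<And>x. x \<notin> N \<Longrightarrow> f' x = f x"
    using borel_version[OF \<mu> f] by blast
  let ?\<rho> = "\<lambda>x. (\<infinity> :: ennreal) * indicator N x"
  have \<rho>: "?\<rho> \<in> borel_measurable borel" using N(1) by simp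
  have "almost_every_curve p \<mu> UNIV (\<lambda>c. line_integral c ?\<rho> < \<infinity>)"
    using \<rho> N(2) p by (intro almost_every_curve_finite_line_integral in_Lp_infinity_null_set) auto
  then show ?thesis
  proof (rule almost_every_curve_mono)
    fix c :: "real \<times> (real \<Rightarrow> 'a)"
    assume c: "c \<in> curves UNIV" and fin: "line_integral c ?\<rho> < \<infinity>"
    obtain l \<gamma> where c_eq: "c = (l, \<gamma>)" by (cases c)
    let ?M = "lebesgue_on {0..l}"
    define Z where "Z = {t \<in> {0..l}. \<gamma> t \<in> N}"
    have m: "(\<lambda>t. ?\<rho> (\<gamma> t)) \<in> borel_measurable ?M" "(\<lambda>t. f' (\<gamma> t)) \<in> borel_measurable ?M"
      using c \<rho> f' unfolding c_eq by (auto intro: measurable_curve_comp)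
    have "AE t in ?M. ?\<rho> (\<gamma> t) \<noteq> \<infinity>"
      using nn_integral_noteq_infinite[OF m(1)] fin by (auto simp: line_integral_def c_eq)
    then have "AE t in ?M. t \<notin> Z"
      by eventually_elim (auto simp: Z_def)
    then have "AE t in lebesgue. t \<notin> Z"
      by (subst (asm) AE_restrict_space_iff) (auto simp: Z_def elim!: eventually_mono)
    then have Z: "Z \<in> null_sets lebesgue" by (simp add: AE_iff_null_sets[symmetric] eventually_ae_filter)
        (metis (no_types, lifting) null_sets_completion_subset subsetI mem_Collect_eq)
    have "(\<lambda>t. f (\<gamma> t)) \<in> borel_measurable ?M"
    proof (rule measurableI)
      fix A :: "ennreal set" assume "A \<in> sets borel"
      then have "(\<lambda>t. f' (\<gamma> t)) -` A \<inter> {0..l} \<in> sets ?M"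
        using measurable_sets[OF m(2)] by simp
      then have 1: "(\<lambda>t. f' (\<gamma> t)) -` A \<inter> {0..l} \<in> sets lebesgue"
        by (subst (asm) sets_restrict_space_iff) auto
      have 2: "(\<lambda>t. f (\<gamma> t)) -` A \<inter> Z \<in> null_sets lebesgue"
        by (rule null_sets_completion_subset[OF _ Z]) auto
      have "(\<lambda>t. f (\<gamma> t)) -` A \<inter> {0..l} =
          ((\<lambda>t. f' (\<gamma> t)) -` A \<inter> {0..l} - Z) \<union> ((\<lambda>t. f (\<gamma> t)) -` A \<inter> Z)"
        using eq by (auto simp: Z_def)
      also have "\<dots> \<in> sets lebesgue"
        using 1 2 Z by (intro sets.Un sets.Diff) auto
      finally show "(\<lambda>t. f (\<gamma> t)) -` A \<inter> space ?M \<in> sets ?M"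
        by (subst sets_restrict_space_iff) auto
    qed auto
    then show "case c of (l, \<gamma>) \<Rightarrow> (\<lambda>t. f (\<gamma> t)) \<in> borel_measurable (lebesgue_on {0..l})"
      by (simp add: c_eq)
  qed
qed

text \<open>If \<open>P\<close> fails on a subcurve in \<open>S\<close>, a test function for
  \<open>P\<close> has infinite integral over that piece, hence its Borel majorant has one over the
  whole curve. So a single \<rho> handles all subcurves at once, although they are uncountably
  many.\<close>

lemma almost_every_curve_subcurves:
  fixes \<mu> :: "'a::metric_space measure"
  assumes \<mu>: "metric_measure \<mu>" and p: "1 \<le> p" and S: "S \<in> sets \<mu>"
    and P: "almost_every_curve p \<mu> S P"
  shows "almost_every_curve p \<mu> UNIV (\<lambda>(l, \<gamma>). \<forall>a b. 0 \<le> a \<longrightarrow> a < b \<longrightarrow> b \<le> l \<longrightarrow>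
           \<gamma> ` {a..b} \<subseteq> S \<longrightarrow> P (b - a, \<lambda>t. \<gamma> (a + t)))"
proof -
  obtain \<rho>0 where \<rho>0: "in_Lp p (restrict_space \<mu> S) \<rho>0"
    "\<And>c. c \<in> curves S \<Longrightarrow> \<not> P c \<Longrightarrow> line_integral c \<rho>0 = \<infinity>"
    using P unfolding almost_every_curve_def zero_modulus_def by auto
  obtain \<rho> where \<rho>: "\<rho> \<in> borel_measurable borel" "in_Lp p \<mu> \<rho>" "\<And>x. x \<in> S \<Longrightarrow> \<rho>0 x \<le> \<rho> x"
    using borel_majorant[OF \<mu> S _ \<rho>0(1)] p by auto
  have "P (b - a, \<lambda>t. \<gamma> (a + t))"
    if c: "(l, \<gamma>) \<in> curves UNIV" and fin: "line_integral (l, \<gamma>) \<rho> < \<infinity>"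
      and ab: "0 \<le> a" "a < b" "b \<le> l" and sub: "\<gamma> ` {a..b} \<subseteq> S" for l \<gamma> a b
  proof (rule ccontr)
    assume "\<not> ?thesis"
    then have "\<infinity> = line_integral (b - a, \<lambda>t. \<gamma> (a + t)) \<rho>0"
      using \<rho>0(2) subcurve_in_curves[OF c ab sub] by simp
    also have "\<dots> \<le> (\<integral>\<^sup>+t. \<rho> (\<gamma> (a + t)) \<partial>lebesgue_on {0..b - a})"
      unfolding line_integral_def prod.case using \<rho>(3) sub
      by (intro nn_integral_mono) (auto simp: image_subset_iff)
    also have "\<dots> = (\<integral>\<^sup>+t. \<rho> (\<gamma> t) \<partial>lebesgue_on {a..b})"
      using ab by (intro nn_integral_lebesgue_on_shift
          measurable_lebesgue_on_subset[OF measurable_curve_comp[OF c \<rho>(1)]]) auto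
    also have "\<dots> \<le> line_integral (l, \<gamma>) \<rho>"
      unfolding line_integral_def prod.case using ab by (intro nn_integral_lebesgue_on_mono) auto
    finally show False using fin by (simp add: top_unique)
  qed
  then show ?thesis
    by (intro almost_every_curve_mono[OF almost_every_curve_finite_line_integral[OF \<rho>(1,2)]]) auto
qed

subsection \<open>Local integrability along almost every curve\<close>

text \<open>A maximal separated subset is a net, and it is finite because the disjoint balls around its
  points have measure at least \<open>\<delta>\<close> and lie in one ball of finite measure.\<close>

lemma separated_finite_net:
  fixes \<mu> :: "'a::metric_space measure"
  assumes \<mu>: "metric_measure \<mu>" and r: "0 < r" and \<delta>: "0 < (\<delta>::real)"
    and E: "\<And>x. x \<in> E \<Longrightarrow> dist z x < R" "\<And>x. x \<in> E \<Longrightarrow> ennreal \<delta> \<le> emeasure \<mu> (ball x (r / 2))"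
  shows "\<exists>A. finite A \<and> A \<subseteq> E \<and> E \<subseteq> (\<Union>a\<in>A. ball a r)"
proof -
  have ball: "ball x s \<in> sets \<mu>" for x s
    using metric_measure_sets_borel(2)[OF \<mu>] by auto
  define sep where "sep A \<longleftrightarrow> finite A \<and> A \<subseteq> E \<and> (\<forall>x\<in>A. \<forall>y\<in>A. x \<noteq> y \<longrightarrow> r \<le> dist x y)" for A
  \<comment> \<open>This ball contains all the disjoint balls of radius \<open>r / 2\<close>; the
    absolute value makes its radius positive whatever \<open>R\<close> is, so that its measure is
    finite.\<close>
  define m where "m = enn2real (emeasure \<mu> (ball z (\<bar>R\<bar> + r)))"
  have m: "emeasure \<mu> (ball z (\<bar>R\<bar> + r)) = ennreal m"
    using \<mu> r by (simp add: m_def metric_measure_def less_top)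
  have card: "card A \<le> nat \<lceil>m / \<delta>\<rceil>" if "sep A" for A
  proof -
    have A: "finite A" "A \<subseteq> E" "\<And>x y. x \<in> A \<Longrightarrow> y \<in> A \<Longrightarrow> x \<noteq> y \<Longrightarrow> r \<le> dist x y"
      using that by (auto simp: sep_def)
    have disj: "disjoint_family_on (\<lambda>x. ball x (r / 2)) A"
      unfolding disjoint_family_on_def
    proof (intro ballI impI)
      fix x y assume xy: "x \<in> A" "y \<in> A" "x \<noteq> y"
      show "ball x (r / 2) \<inter> ball y (r / 2) = {}"
      proof (rule ccontr)
        assume "\<not> ?thesis"
        then obtain w where "dist x w < r / 2" "dist y w < r / 2" by auto
        then show False using A(3)[OF xy] dist_triangle2[of x y w] by linarith
      qed
    qed
    have "ennreal (of_nat (card A) * \<delta>) = (\<Sum>x\<in>A. ennreal \<delta>)"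
      using \<delta> by (simp add: ennreal_mult ennreal_of_nat_eq_real_of_nat)
    also have "\<dots> \<le> (\<Sum>x\<in>A. emeasure \<mu> (ball x (r / 2)))"
      using A(2) E(2) by (intro sum_mono) auto
    also have "\<dots> = emeasure \<mu> (\<Union>x\<in>A. ball x (r / 2))"
      using A(1) disj ball by (intro sum_emeasure) auto
    also have "\<dots> \<le> emeasure \<mu> (ball z (\<bar>R\<bar> + r))"
    proof (intro emeasure_mono UN_least subsetI)
      fix x w assume "x \<in> A" "w \<in> ball x (r / 2)"
      then have "dist z x < R" "dist x w < r / 2" using A(2) E(1) by auto
      then show "w \<in> ball z (\<bar>R\<bar> + r)" using dist_triangle[of z w x] r by simp
    qed (rule ball)
    finally have "of_nat (card A) * \<delta> \<le> m"
      unfolding m by (subst (asm) ennreal_le_iff) (simp_all add: m_def)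
    then have "real (card A) \<le> m / \<delta>" using \<delta> by (simp add: field_simps)
    then show ?thesis by linarith
  qed
  have "sep {}" by (simp add: sep_def)
  \<comment> \<open>Cardinalities of separated sets are bounded, so one of greatest cardinality
    exists; a point that its balls leave uncovered could be added to it.\<close>
  then have "\<exists>A. sep A \<and> (\<forall>B. sep B \<longrightarrow> card B \<le> card A)"
    by (rule Lattices_Big.ex_has_greatest_nat[where b = "Suc (nat \<lceil>m / \<delta>\<rceil>)"])
      (use card in \<open>auto simp: less_Suc_eq_le\<close>)
  then obtain A where A: "sep A" "\<And>B. sep B \<Longrightarrow> card B \<le> card A" by auto
  have "x \<in> (\<Union>a\<in>A. ball a r)" if "x \<in> E" for x
  proof (rule ccontr)
    assume "\<not> ?thesis"
    then have far: "\<And>a. a \<in> A \<Longrightarrow> r \<le> dist a x" by (auto simp: not_less)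
    then have "x \<notin> A" using r by force
    moreover have "sep (insert x A)"
      using A(1) far that by (auto simp: sep_def dist_commute)
    ultimately show False using A(2)[of "insert x A"] A(1) by (simp add: sep_def)
  qed
  then show ?thesis using A(1) by (auto simp: sep_def)
qed

text \<open>\<open>S\<close> is exhausted by countably many sets, each with a finite net by
  \<open>separated_finite_net\<close>. It suffices to keep, for each net point, one member of \<B>
  that contains the ball of the net's radius.\<close>

lemma metric_measure_Lindelof:
  fixes \<mu> :: "'a::metric_space measure" and \<B> :: "'a set set"
  assumes \<mu>: "metric_measure \<mu>" and op: "\<And>B. B \<in> \<B> \<Longrightarrow> open B" and cov: "S \<subseteq> \<Union>\<B>"
  obtains \<C> where "countable \<C>" "\<C> \<subseteq> \<B>" "S \<subseteq> \<Union>\<C>"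
proof -
  fix z :: 'a
  define r where "r n = 1 / real (Suc n)" for n
  have r: "0 < r n" for n by (simp add: r_def)
  \<comment> \<open>The index fixes a radius whose ball fits into a member of \<B>, a lower bound
    for the measure of the half ball and a bound for the distance to \<open>z\<close>. The sequence
    \<open>r\<close> serves for the radii and for the measure bounds.\<close>
  define E where "E = (\<lambda>(n, k, j). {x \<in> S. (\<exists>B\<in>\<B>. ball x (r n) \<subseteq> B) \<and> dist z x < real j \<and>
      ennreal (r k) \<le> emeasure \<mu> (ball x (r n / 2))})"
  have "\<forall>q. \<exists>A. finite A \<and> A \<subseteq> E q \<and> E q \<subseteq> (\<Union>a\<in>A. ball a (r (fst q)))"
  proof
    fix q :: "nat \<times> nat \<times> nat"
    obtain n k j where q: "q = (n, k, j)" by (cases q)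
    show "\<exists>A. finite A \<and> A \<subseteq> E q \<and> E q \<subseteq> (\<Union>a\<in>A. ball a (r (fst q)))"
      unfolding q fst_conv
      by (rule separated_finite_net[OF \<mu> r r, where z = z and R = "real j"]) (auto simp: E_def)
  qed
  then obtain A where A: "\<And>q. finite (A q)" "\<And>q. A q \<subseteq> E q"
    "\<And>q. E q \<subseteq> (\<Union>a\<in>A q. ball a (r (fst q)))"
    by metis
  have "\<exists>B\<in>\<B>. ball a (r (fst q)) \<subseteq> B" if "a \<in> A q" for a q
    using that A(2)[of q] by (auto simp: E_def split: prod.splits)
  then obtain B where B: "\<And>a q. a \<in> A q \<Longrightarrow> B a q \<in> \<B> \<and> ball a (r (fst q)) \<subseteq> B a q"
    by metis
  define \<C> where "\<C> = (\<Union>q. (\<lambda>a. B a q) ` A q)"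
  show thesis
  proof (rule that)
    show "countable \<C>" unfolding \<C>_def using A(1)
      by (intro countable_UN countableI_type countable_image countable_finite)
    show "\<C> \<subseteq> \<B>" using B by (auto simp: \<C>_def)
    show "S \<subseteq> \<Union>\<C>"
    proof
      fix x assume x: "x \<in> S"
      then obtain C where C: "C \<in> \<B>" "x \<in> C" using cov by auto
      then obtain e where e: "0 < e" "ball x e \<subseteq> C" using op openE by metis
      obtain n where n: "r n < e"
        using reals_Archimedean[OF e(1)] by (auto simp: r_def inverse_eq_divide)
      have pos: "0 < emeasure \<mu> (ball x (r n / 2))" "emeasure \<mu> (ball x (r n / 2)) < \<infinity>"
        using \<mu> r[of n] by (auto simp: metric_measure_def)
      then have "0 < enn2real (emeasure \<mu> (ball x (r n / 2)))"
        by (simp add: enn2real_positive_iff)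
      then obtain k where k: "r k < enn2real (emeasure \<mu> (ball x (r n / 2)))"
        using reals_Archimedean by (auto simp: r_def inverse_eq_divide)
      have "ennreal (r k) \<le> emeasure \<mu> (ball x (r n / 2))"
        using ennreal_leI[OF less_imp_le[OF k]] ennreal_enn2real[of "emeasure \<mu> (ball x (r n / 2))"] pos
        by (metis infinity_ennreal_def)
      moreover obtain j where "dist z x < real j" using reals_Archimedean2 by blast
      moreover have "ball x (r n) \<subseteq> C" using e(2) n by auto
      ultimately have "x \<in> E (n, k, j)" using x C(1) by (auto simp: E_def)
      then obtain a where "a \<in> A (n, k, j)" "x \<in> ball a (r n)" using A(3)[of "(n, k, j)"] by auto
      then show "x \<in> \<Union>\<C>" using B[of a "(n, k, j)"] by (fastforce simp: \<C>_def)
    qed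
  qed
qed

text \<open>By the Lindelof property, countably many open sets on which \<open>f\<close> has a Borel
  majorant in L^p cover \<open>S\<close>, and almost every curve has finite line integrals of all
  these majorants. A compact piece of a curve needs finitely many of the sets, and the sum of their
  majorants dominates \<open>f\<close> on it.\<close>

lemma almost_every_curve_locally_integrable:
  fixes \<mu> :: "'a::metric_space measure"
  assumes \<mu>: "metric_measure \<mu>" and p: "1 \<le> p" and S: "S \<in> sets \<mu>" and f: "in_Lp_loc p \<mu> S f"
  shows "almost_every_curve p \<mu> UNIV (\<lambda>(l, \<gamma>). \<forall>a b. 0 \<le> a \<longrightarrow> b \<le> l \<longrightarrow>
           \<gamma> ` {a..b} \<subseteq> S \<longrightarrow> (\<integral>\<^sup>+t. f (\<gamma> t) \<partial>lebesgue_on {a..b}) < \<infinity>)"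
proof -
  define \<B> where "\<B> = {B. open B \<and> in_Lp p (restrict_space \<mu> (B \<inter> S)) f}"
  have "S \<subseteq> \<Union>\<B>"
    using f by (fastforce simp: \<B>_def in_Lp_loc_def locally_on_balls_def)
  then obtain \<C> where \<C>: "countable \<C>" "\<C> \<subseteq> \<B>" "S \<subseteq> \<Union>\<C>"
    using metric_measure_Lindelof[OF \<mu>, of \<B> S] by (auto simp: \<B>_def)
  have "\<exists>\<rho>. \<rho> \<in> borel_measurable borel \<and> in_Lp p \<mu> \<rho> \<and> (\<forall>x\<in>B \<inter> S. f x \<le> \<rho> x)"
    if "B \<in> \<C>" for B
  proof -
    have B: "open B" "in_Lp p (restrict_space \<mu> (B \<inter> S)) f" using that \<C>(2) by (auto simp: \<B>_def)
    have "B \<inter> S \<in> sets \<mu>"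
      using subsetD[OF metric_measure_sets_borel(2)[OF \<mu>] borel_open[OF B(1)]] S by (rule sets.Int)
    from borel_majorant[OF \<mu> this _ B(2)] p show ?thesis by (metis less_le_trans zero_less_one)
  qed
  then obtain \<rho> where \<rho>: "\<And>B. B \<in> \<C> \<Longrightarrow> \<rho> B \<in> borel_measurable borel"
    "\<And>B. B \<in> \<C> \<Longrightarrow> in_Lp p \<mu> (\<rho> B)" "\<And>B x. B \<in> \<C> \<Longrightarrow> x \<in> B \<Longrightarrow> x \<in> S \<Longrightarrow> f x \<le> \<rho> B x"
    by (metis IntI)
  have "almost_every_curve p \<mu> UNIV (\<lambda>c. \<forall>B\<in>\<C>. line_integral c (\<rho> B) < \<infinity>)"
    using \<rho> by (intro almost_every_curve_all_countable[OF \<mu> p \<C>(1)]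
        almost_every_curve_finite_line_integral)
  moreover have "(\<integral>\<^sup>+t. f (\<gamma> t) \<partial>lebesgue_on {a..b}) < \<infinity>"
    if c: "(l, \<gamma>) \<in> curves UNIV" and fin: "\<forall>B\<in>\<C>. line_integral (l, \<gamma>) (\<rho> B) < \<infinity>"
      and ab: "0 \<le> a" "b \<le> l" and sub: "\<gamma> ` {a..b} \<subseteq> S" for l \<gamma> a b
  proof -
    have "continuous_on {a..b} \<gamma>"
      using c ab by (auto simp: curves_def intro: continuous_on_subset)
    then have "compact (\<gamma> ` {a..b})" by (intro compact_continuous_image) auto
    then obtain F where F: "F \<subseteq> \<C>" "finite F" "\<gamma> ` {a..b} \<subseteq> \<Union>F"
      using \<C> sub by (elim compactE[of _ \<C>]) (auto simp: \<B>_def)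
    have [measurable]: "(\<lambda>t. \<rho> B (\<gamma> t)) \<in> borel_measurable (lebesgue_on {a..b})" if "B \<in> F" for B
      using that F(1) \<rho>(1) ab
      by (intro measurable_lebesgue_on_subset[OF measurable_curve_comp[OF c]]) auto
    have "f (\<gamma> t) \<le> (\<Sum>B\<in>F. \<rho> B (\<gamma> t))" if t: "t \<in> {a..b}" for t
    proof -
      obtain B where B: "B \<in> F" "\<gamma> t \<in> B" using F(3) t by blast
      then have "f (\<gamma> t) \<le> \<rho> B (\<gamma> t)" using \<rho>(3) F(1) sub t by blast
      also have "\<dots> \<le> (\<Sum>B\<in>F. \<rho> B (\<gamma> t))"
        using B(1) F(2) by (intro member_le_sum) auto
      finally show ?thesis .
    qed
    then have "(\<integral>\<^sup>+t. f (\<gamma> t) \<partial>lebesgue_on {a..b}) \<le> (\<integral>\<^sup>+t. (\<Sum>B\<in>F. \<rho> B (\<gamma> t)) \<partial>lebesgue_on {a..b})"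
      by (intro nn_integral_mono) auto
    also have "\<dots> = (\<Sum>B\<in>F. \<integral>\<^sup>+t. \<rho> B (\<gamma> t) \<partial>lebesgue_on {a..b})"
      by (intro nn_integral_sum) auto
    also have "\<dots> \<le> (\<Sum>B\<in>F. line_integral (l, \<gamma>) (\<rho> B))"
      unfolding line_integral_def prod.case
      using ab by (intro sum_mono nn_integral_lebesgue_on_mono) auto
    also have "\<dots> < \<infinity>" using fin F by (auto simp: less_top)
    finally show ?thesis .
  qed
  ultimately show ?thesis
    by (elim almost_every_curve_mono) auto
qed

subsection \<open>Gluing weak upper gradients\<close>

text \<open>Two infinite values have infinite \<open>abs_diff\<close> by convention, as do a finite
  and an infinite one. This makes \<open>u\<close> real-valued at the ends of a curve with a finite
  bound.\<close>

lemma abs_diff_finite: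
  assumes "abs_diff a b < \<infinity>"
  shows "\<bar>a\<bar> \<noteq> \<infinity>" "\<bar>b\<bar> \<noteq> \<infinity>"
  using assms by (cases a; cases b; auto simp: abs_diff_def)+

lemma abs_diff_eq_ennreal:
  assumes "\<bar>a\<bar> \<noteq> \<infinity>" "\<bar>b\<bar> \<noteq> \<infinity>"
  shows "abs_diff a b = ennreal \<bar>real_of_ereal b - real_of_ereal a\<bar>"
  using assms by (cases a; cases b) (auto simp: abs_diff_def abs_minus_commute)

lemma ug_inequality_subcurve:
  assumes "ug_inequality u g (b - a, \<lambda>t. \<gamma> (a + t))"
  shows "(\<lambda>t. g (\<gamma> t)) \<in> borel_measurable (lebesgue_on {a..b})"
    and "abs_diff (u (\<gamma> a)) (u (\<gamma> b)) \<le> (\<integral>\<^sup>+t. g (\<gamma> t) \<partial>lebesgue_on {a..b})"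
proof -
  show m: "(\<lambda>t. g (\<gamma> t)) \<in> borel_measurable (lebesgue_on {a..b})"
  proof -
    \<comment> \<open>The domain \<open>{0..b - a}\<close> is written as a shift of
      \<open>{a..b}\<close> by \<open>- a\<close>, so that translating back restores
      \<open>g (\<gamma> t)\<close>.\<close>
    have "(\<lambda>t. g (\<gamma> (a + t))) \<in> borel_measurable (lebesgue_on {- a + a..- a + b})"
      using assms unfolding ug_inequality_def by simp
    from measurable_lebesgue_on_shift[OF this] show ?thesis
      by (simp only: add.assoc[symmetric] add.right_inverse add_0_left)
  qed
  show "abs_diff (u (\<gamma> a)) (u (\<gamma> b)) \<le> (\<integral>\<^sup>+t. g (\<gamma> t) \<partial>lebesgue_on {a..b})"
    using assms nn_integral_lebesgue_on_shift[OF m]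
    by (simp add: ug_inequality_def line_integral_def)
qed

lemma ug_inequality_glue:
  fixes u :: "'a::metric_space \<Rightarrow> ereal" and g h :: "'a \<Rightarrow> ennreal" and G :: "'a set"
  defines "k \<equiv> \<lambda>x. if x \<in> G then min (g x) (h x) else g x"
  assumes l: "0 < l"
    and g: "\<And>a b. 0 \<le> a \<Longrightarrow> a < b \<Longrightarrow> b \<le> l \<Longrightarrow> ug_inequality u g (b - a, \<lambda>t. \<gamma> (a + t))"
    and h: "\<And>a b. 0 \<le> a \<Longrightarrow> a < b \<Longrightarrow> b \<le> l \<Longrightarrow> \<gamma> ` {a..b} \<subseteq> G \<Longrightarrow>
              ug_inequality u h (b - a, \<lambda>t. \<gamma> (a + t))"
    and g_fin: "(\<integral>\<^sup>+t. g (\<gamma> t) \<partial>lebesgue_on {0..l}) < \<infinity>"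
    and h_fin: "\<And>a b. 0 \<le> a \<Longrightarrow> b \<le> l \<Longrightarrow> \<gamma> ` {a..b} \<subseteq> G \<Longrightarrow>
              (\<integral>\<^sup>+t. h (\<gamma> t) \<partial>lebesgue_on {a..b}) < \<infinity>"
    and U: "openin (top_of_set {0..l}) U" and N: "N \<in> null_sets lebesgue"
    and UN: "{t \<in> {0..l}. \<gamma> t \<in> G} = U \<union> N"
    and k: "(\<lambda>t. k (\<gamma> t)) \<in> borel_measurable (lebesgue_on {0..l})"
  shows "ug_inequality u k (l, \<gamma>)"
proof -
  obtain T where T: "open T" "U = {0..l} \<inter> T" using U by (auto simp: openin_open)
  have g_fin': "(\<integral>\<^sup>+t. g (\<gamma> t) \<partial>lebesgue_on {a..b}) < \<infinity>" if "0 \<le> a" "b \<le> l" for a b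
    using nn_integral_lebesgue_on_mono[of "{a..b}" "{0..l}" "\<lambda>t. g (\<gamma> t)"] that g_fin
    by (auto intro: le_less_trans)
  define f where "f t = real_of_ereal (u (\<gamma> t))" for t
  have diff_fin: "abs_diff (u (\<gamma> a)) (u (\<gamma> b)) < \<infinity>" if "0 \<le> a" "a < b" "b \<le> l" for a b
    using ug_inequality_subcurve(2)[OF g[OF that]] g_fin'[of a b] that by (auto intro: le_less_trans)
  \<comment> \<open>Every parameter is an endpoint of a nondegenerate subinterval,
    \<open>{t..l}\<close> or, for \<open>t = l\<close>, \<open>{0..t}\<close>. So \<open>u\<close>
    is real along the curve and \<open>f\<close> loses no information.\<close>
  have "\<bar>u (\<gamma> t)\<bar> \<noteq> \<infinity>" if "0 \<le> t" "t \<le> l" for t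
    using abs_diff_finite(1)[OF diff_fin[of t l]] abs_diff_finite(2)[OF diff_fin[of 0 t]] that l
    by (cases "t = l") auto
  then have f: "abs_diff (u (\<gamma> a)) (u (\<gamma> b)) = ennreal \<bar>f b - f a\<bar>"
    if "0 \<le> a" "a \<le> b" "b \<le> l" for a b
    using that unfolding f_def by (intro abs_diff_eq_ennreal) auto
  have g': "(\<lambda>t. g (\<gamma> t)) \<in> borel_measurable (lebesgue_on {a..b})"
    "ennreal \<bar>f b - f a\<bar> \<le> (\<integral>\<^sup>+t. g (\<gamma> t) \<partial>lebesgue_on {a..b})"
    if "0 \<le> a" "a < b" "b \<le> l" for a b
    using ug_inequality_subcurve[OF g[OF that]] f[of a b] that by auto
  have in_G: "\<gamma> ` {a..b} \<subseteq> G" if "0 \<le> a" "b \<le> l" "{a..b} \<subseteq> T" for a b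
    using that T(2) UN by auto
  have k_fin: "(\<integral>\<^sup>+t. k (\<gamma> t) \<partial>lebesgue_on {0..l}) < \<infinity>"
    using g_fin by (rule le_less_trans[rotated]) (intro nn_integral_mono, auto simp: k_def)
  \<comment> \<open>The minimum of \<open>g\<close> and \<open>h\<close> is first treated on intervals mapped into \<open>G\<close>, as \<open>h \<circ> \<gamma>\<close> need
    only be locally integrable on \<open>U\<close>; then \<open>k \<circ> \<gamma>\<close>, which is integrable, takes the role of \<open>h \<circ> \<gamma>\<close>.\<close>
  have inside: "ennreal \<bar>f b - f a\<bar> \<le> (\<integral>\<^sup>+t. k (\<gamma> t) \<partial>lebesgue_on {a..b})"
    if ab: "0 \<le> a" "a < b" "b \<le> l" "{a..b} \<subseteq> T" for a b
  proof -
    let ?W = "\<lambda>t. min (g (\<gamma> t)) (h (\<gamma> t))"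
    have h': "(\<lambda>t. h (\<gamma> t)) \<in> borel_measurable (lebesgue_on {c..d})"
      "ennreal \<bar>f d - f c\<bar> \<le> (\<integral>\<^sup>+t. h (\<gamma> t) \<partial>lebesgue_on {c..d})"
      if cd: "a \<le> c" "c < d" "d \<le> b" for c d
    proof -
      have sub: "0 \<le> c" "d \<le> l" "{c..d} \<subseteq> T" using cd ab by auto
      show "(\<lambda>t. h (\<gamma> t)) \<in> borel_measurable (lebesgue_on {c..d})"
        "ennreal \<bar>f d - f c\<bar> \<le> (\<integral>\<^sup>+t. h (\<gamma> t) \<partial>lebesgue_on {c..d})"
        using ug_inequality_subcurve[OF h[OF sub(1) cd(2) sub(2) in_G[OF sub]]] f[of c d] cd(2) sub(1,2)
        by auto
    qed
    have W: "?W \<in> borel_measurable (lebesgue_on {a..b})"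
      using g'(1)[of a b] h'(1)[of a b] ab by simp
    have W_fin: "(\<integral>\<^sup>+t. ?W t \<partial>lebesgue_on {a..b}) < \<infinity>"
      using g_fin'[OF ab(1,3)] by (rule le_less_trans[rotated]) (intro nn_integral_mono, simp)
    \<comment> \<open>On such an interval the curve stays in \<open>G\<close>, so the bound by
      \<open>h\<close> holds on every subinterval and \<open>UNIV\<close> can serve as the open
      set.\<close>
    have "ennreal \<bar>f b - f a\<bar> \<le> (\<integral>\<^sup>+t. ?W t \<partial>lebesgue_on {a..b})"
    proof (rule ennreal_abs_increment_le_nn_integral[OF less_imp_le[OF ab(2)] open_UNIV
          g'(1)[OF ab(1-3)] g_fin'[OF ab(1,3)] _ h_fin[OF ab(1,3) in_G[OF ab(1,3,4)]] W W_fin])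
      show "AE t in lebesgue_on {a..b}. ?W t = g (\<gamma> t) \<or> t \<in> UNIV \<and> ?W t = h (\<gamma> t)"
        by (simp add: min_def)
    qed (use ab g'(2) h' in auto)
    also have "\<dots> = (\<integral>\<^sup>+t. k (\<gamma> t) \<partial>lebesgue_on {a..b})"
      using in_G[OF ab(1,3,4)] by (intro nn_integral_cong) (auto simp: k_def image_subset_iff)
    finally show ?thesis .
  qed
  have "AE t in lebesgue. t \<notin> N" by (rule AE_not_in[OF N])
  then have "AE t in lebesgue_on {0..l}. t \<notin> N"
    by (subst AE_restrict_space_iff) auto
  \<comment> \<open>With \<open>k\<close> in place of both \<open>B\<close> and \<open>W\<close>,
    the second alternative only says \<open>t \<in> T\<close>. Outside \<open>N\<close>, a parameter
    not in \<open>T\<close> is mapped outside \<open>G\<close>, where \<open>k\<close> is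
    \<open>g\<close>.\<close>
  then have cases: "AE t in lebesgue_on {0..l}. k (\<gamma> t) = g (\<gamma> t) \<or> t \<in> T \<and> k (\<gamma> t) = k (\<gamma> t)"
    using AE_space
  proof eventually_elim
    case (elim t)
    then show ?case using UN T(2) by (auto simp: k_def)
  qed
  have "ennreal \<bar>f l - f 0\<bar> \<le> (\<integral>\<^sup>+t. k (\<gamma> t) \<partial>lebesgue_on {0..l})"
    using l by (intro ennreal_abs_increment_le_nn_integral[OF _ T(1) _ _ k k_fin k k_fin _ _ cases]
        g' g_fin inside) auto
  then show ?thesis
    using k f[of 0 l] l by (simp add: ug_inequality_def line_integral_def)
qed

lemma weak_upper_gradient_glue:
  fixes \<mu> :: "'a::metric_space measure" and u :: "'a \<Rightarrow> ereal"
  assumes p: "1 \<le> p" and \<mu>: "metric_measure \<mu>" and G: "G \<in> sets \<mu>" "path_almost_open p \<mu> G"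
    and g: "weak_upper_gradient p \<mu> UNIV u g" "in_Lp_loc p \<mu> UNIV g"
    and h: "weak_upper_gradient p \<mu> G u h" "in_Lp_loc p \<mu> G h"
  shows "weak_upper_gradient p \<mu> UNIV u (\<lambda>x. if x \<in> G then min (g x) (h x) else g x)"
proof -
  let ?k = "\<lambda>x. if x \<in> G then min (g x) (h x) else g x"
  have G': "G \<inter> space \<mu> \<in> sets \<mu>" using G(1) by auto
  \<comment> \<open>\<open>h\<close> is known to be measurable on \<open>G\<close> only; its
    extension by 0 is measurable everywhere and agrees with \<open>h\<close> where \<open>?k\<close>
    uses it.\<close>
  have [measurable]: "g \<in> borel_measurable \<mu>" "(\<lambda>x. h x * indicator G x) \<in> borel_measurable \<mu>"
    using g(1) h(1) borel_measurable_restrict_space_iff_ennreal[OF G']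
    by (auto simp: weak_upper_gradient_def)
  note [measurable] = G(1)
  have "(\<lambda>x. if x \<in> G then min (g x) (h x * indicator G x) else g x) \<in> borel_measurable \<mu>"
    by measurable
  also have "(\<lambda>x. if x \<in> G then min (g x) (h x * indicator G x) else g x) = ?k" by auto
  finally have k: "?k \<in> borel_measurable \<mu>" .
  have UNIV: "UNIV \<in> sets \<mu>"
    using metric_measure_sets_borel[OF \<mu>] sets.top[of \<mu>] by simp
  have gh: "almost_every_curve p \<mu> UNIV (ug_inequality u g)"
    "almost_every_curve p \<mu> G (ug_inequality u h)"
    using g(1) h(1) by (auto simp: weak_upper_gradient_def)
  note conj = almost_every_curve_conj[OF \<mu> p]
  \<comment> \<open>Off the union of these six exceptional families, a curve satisfies the premises
    of \<open>ug_inequality_glue\<close>.\<close>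
  note good = conj[OF almost_every_curve_subcurves[OF \<mu> p UNIV gh(1)]
      conj[OF almost_every_curve_subcurves[OF \<mu> p G(1) gh(2)]
      conj[OF almost_every_curve_locally_integrable[OF \<mu> p UNIV g(2)]
      conj[OF almost_every_curve_locally_integrable[OF \<mu> p G(1) h(2)]
      conj[OF G(2)[unfolded path_almost_open_def] almost_every_curve_measurable[OF \<mu> p k]]]]]]
  have "almost_every_curve p \<mu> UNIV (ug_inequality u ?k)"
  proof (rule almost_every_curve_mono[OF good], simp only: split_paired_all prod.case, elim exE conjE)
    fix l U N and \<gamma> :: "real \<Rightarrow> 'a"
    assume "(l, \<gamma>) \<in> curves UNIV"
    then have l: "0 < l" by (simp add: curves_def)
    assume *: "\<forall>a b. 0 \<le> a \<longrightarrow> a < b \<longrightarrow> b \<le> l \<longrightarrow> \<gamma> ` {a..b} \<subseteq> UNIV \<longrightarrow>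
        ug_inequality u g (b - a, \<lambda>t. \<gamma> (a + t))"
      "\<forall>a b. 0 \<le> a \<longrightarrow> a < b \<longrightarrow> b \<le> l \<longrightarrow> \<gamma> ` {a..b} \<subseteq> G \<longrightarrow>
        ug_inequality u h (b - a, \<lambda>t. \<gamma> (a + t))"
      "\<forall>a b. 0 \<le> a \<longrightarrow> b \<le> l \<longrightarrow> \<gamma> ` {a..b} \<subseteq> UNIV \<longrightarrow>
        (\<integral>\<^sup>+t. g (\<gamma> t) \<partial>lebesgue_on {a..b}) < \<infinity>"
      "\<forall>a b. 0 \<le> a \<longrightarrow> b \<le> l \<longrightarrow> \<gamma> ` {a..b} \<subseteq> G \<longrightarrow>
        (\<integral>\<^sup>+t. h (\<gamma> t) \<partial>lebesgue_on {a..b}) < \<infinity>"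
      "openin (top_of_set {0..l}) U" "N \<in> null_sets lebesgue" "{t \<in> {0..l}. \<gamma> t \<in> G} = U \<union> N"
      "(\<lambda>t. ?k (\<gamma> t)) \<in> borel_measurable (lebesgue_on {0..l})"
    show "ug_inequality u ?k (l, \<gamma>)"
      by (rule ug_inequality_glue[OF l _ _ _ _ *(5-8)]) (use *(1-4) in auto)
  qed
  then show ?thesis using k by (simp add: weak_upper_gradient_def)
qed

section \<open>Restriction to subsets and minimality\<close>

lemma in_Lp_loc_mono:
  fixes \<mu> :: "'a::metric_space measure"
  assumes \<mu>: "metric_measure \<mu>" and p: "1 \<le> p"
    and S: "S \<in> sets \<mu>" and T: "T \<in> sets \<mu>" "T \<subseteq> S"
    and f: "in_Lp_loc p \<mu> S f" and g: "g \<in> borel_measurable (restrict_space \<mu> T)"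
    and le: "\<And>x. x \<in> T \<Longrightarrow> g x \<le> f x"
  shows "in_Lp_loc p \<mu> T g"
  unfolding in_Lp_loc_def locally_on_balls_def
proof
  fix x assume x: "x \<in> T"
  then obtain c r where c: "x \<in> ball c r" "in_Lp p (restrict_space \<mu> (ball c r \<inter> S)) f"
    using f T(2) unfolding in_Lp_loc_def locally_on_balls_def by blast
  \<comment> \<open>The centre \<open>c\<close> need not lie in \<open>T\<close>, so a smaller ball
    around \<open>x\<close> itself is used.\<close>
  obtain e where e: "0 < e" "ball x e \<subseteq> ball c r"
    using c(1) openE[OF open_ball] by metis
  have ball: "ball y s \<in> sets \<mu>" for y s
    using subsetD[OF metric_measure_sets_borel(2)[OF \<mu>] borel_open[OF open_ball]] .
  have "restrict_space (restrict_space \<mu> T) (ball x e) = restrict_space \<mu> (ball x e \<inter> T)"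
    using T(1) ball[of x e] by (subst restrict_restrict_space) (auto simp: Int_commute)
  then have "g \<in> borel_measurable (restrict_space \<mu> (ball x e \<inter> T))"
    using measurable_restrict_space1[OF g, of "ball x e"] by simp
  then have "in_Lp p (restrict_space \<mu> (ball x e \<inter> T)) g"
    using T e(2) S ball le p by (intro in_Lp_restrict_space_mono[OF c(2)]) auto
  then show "\<exists>c\<in>T. \<exists>r>0. x \<in> ball c r \<and> in_Lp p (restrict_space \<mu> (ball c r \<inter> T)) g"
    using x e(1) by (intro bexI[of _ x] exI[of _ e]) auto
qed

text \<open>Curves in \<open>G\<close> are curves in the whole space with the same line integrals,
  so a test function for the whole space, restricted to \<open>G\<close>, still serves.\<close>

lemma weak_upper_gradient_subset:
  fixes \<mu> :: "'a::metric_space measure"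
  assumes \<mu>: "metric_measure \<mu>" and p: "1 \<le> p" and G: "G \<in> sets \<mu>"
    and g: "weak_upper_gradient p \<mu> UNIV u g"
  shows "weak_upper_gradient p \<mu> G u g"
proof -
  obtain \<rho> where \<rho>: "\<rho> \<in> borel_measurable borel" "in_Lp p \<mu> \<rho>"
    "\<And>c. c \<in> curves UNIV \<Longrightarrow> \<not> ug_inequality u g c \<Longrightarrow> line_integral c \<rho> = \<infinity>"
    and g': "g \<in> borel_measurable \<mu>"
    using g by (auto simp: weak_upper_gradient_def almost_every_curve_def zero_modulus_def)
  have "in_Lp p (restrict_space \<mu> G) \<rho>"
    using in_Lp_restrict_space_mono[of p \<mu> UNIV \<rho> G \<rho>] \<rho>(2) G p metric_measure_sets_borel[OF \<mu>]
      measurable_restrict_space1[OF metric_measure_borel_measurable[OF \<mu> \<rho>(1)], of G] sets.top[of \<mu>]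
    by simp
  then have "almost_every_curve p \<mu> G (ug_inequality u g)"
    unfolding almost_every_curve_def zero_modulus_def
    using \<rho> curves_UNIV[of _ G] by (intro exI[of _ \<rho>]) (simp add: measurable_restrict_space1)
  then show ?thesis
    using g' by (simp add: weak_upper_gradient_def measurable_restrict_space1)
qed

theorem proposition3p5:
  fixes \<mu> :: "'a::metric_space measure" and p :: real
    and G :: "'a set" and u :: "'a \<Rightarrow> ereal" and g\<^sub>u :: "'a \<Rightarrow> ennreal"
  assumes "1 \<le> p"
    and "metric_measure \<mu>"
    and "G \<in> sets \<mu>"
    and "path_almost_open p \<mu> G"
    and "u \<in> Dp_loc p \<mu> UNIV"
    and "minimal_weak_upper_gradient p \<mu> UNIV u g\<^sub>u"
  shows "minimal_weak_upper_gradient p \<mu> G u g\<^sub>u \<and>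
    (\<forall>g. minimal_weak_upper_gradient p \<mu> G u g \<longrightarrow>
         (AE x in restrict_space \<mu> G. g x = g\<^sub>u x))"
proof -
  note p = assms(1) and \<mu> = assms(2) and G = assms(3)
  have UNIV: "UNIV \<in> sets \<mu>"
    using metric_measure_sets_borel[OF \<mu>] sets.top[of \<mu>] by simp
  have g: "weak_upper_gradient p \<mu> UNIV u g\<^sub>u" "in_Lp_loc p \<mu> UNIV g\<^sub>u"
    and min: "\<And>k. weak_upper_gradient p \<mu> UNIV u k \<Longrightarrow> in_Lp_loc p \<mu> UNIV k \<Longrightarrow>
      AE x in \<mu>. g\<^sub>u x \<le> k x"
    using assms(6) unfolding minimal_weak_upper_gradient_def restrict_space_UNIV_eq by blast+
  have gG: "weak_upper_gradient p \<mu> G u g\<^sub>u"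
    by (rule weak_upper_gradient_subset[OF \<mu> p G g(1)])
  moreover have "in_Lp_loc p \<mu> G g\<^sub>u"
    using gG by (intro in_Lp_loc_mono[OF \<mu> p UNIV G _ g(2)]) (auto simp: weak_upper_gradient_def)
  moreover have "AE x in restrict_space \<mu> G. g\<^sub>u x \<le> h x"
    if h: "weak_upper_gradient p \<mu> G u h" "in_Lp_loc p \<mu> G h" for h
  proof -
    let ?k = "\<lambda>x. if x \<in> G then min (g\<^sub>u x) (h x) else g\<^sub>u x"
    have k: "weak_upper_gradient p \<mu> UNIV u ?k"
      by (rule weak_upper_gradient_glue[OF p \<mu> G assms(4) g h])
    \<comment> \<open>\<open>?k\<close> lies below \<open>g\<^sub>u\<close> everywhere, so it
      inherits local integrability.\<close>
    moreover have "in_Lp_loc p \<mu> UNIV ?k"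
      using k by (intro in_Lp_loc_mono[OF \<mu> p UNIV UNIV _ g(2)]) (auto simp: weak_upper_gradient_def)
    ultimately have "AE x in \<mu>. g\<^sub>u x \<le> ?k x" by (rule min)
    then have "AE x in \<mu>. x \<in> G \<longrightarrow> g\<^sub>u x \<le> h x" by eventually_elim auto
    then show ?thesis using G by (subst AE_restrict_space_iff) auto
  qed
  ultimately have *: "minimal_weak_upper_gradient p \<mu> G u g\<^sub>u"
    by (simp add: minimal_weak_upper_gradient_def)
  moreover have "AE x in restrict_space \<mu> G. g x = g\<^sub>u x" if "minimal_weak_upper_gradient p \<mu> G u g" for g
  proof -
    \<comment> \<open>Two minimal weak upper gradients on \<open>G\<close> bound each other
      a.e.\<close>
    have "AE x in restrict_space \<mu> G. g x \<le> g\<^sub>u x" "AE x in restrict_space \<mu> G. g\<^sub>u x \<le> g x"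
      using that * by (auto simp: minimal_weak_upper_gradient_def)
    then show ?thesis by eventually_elim auto
  qed
  ultimately show ?thesis by blast
qed

end
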